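(* Let $\ell>2$ be a prime number and $G$ an open subgroup of $\operatorname{GL}_2(\mathbb{Z}_\ell)^2$. Let $G_1,G_2$ be the projections of $G$ on the two factors $\operatorname{GL}_2(\mathbb{Z}_\ell)$, and for $i=1,2$ let $n_i$ be a positive integer such that $G_i$ contains $\mathcal{B}_\ell(n_i)$. Suppose furthermore that for every $(g_1,g_2)\in G$ we have $\det(g_1)=\det(g_2)$. At least one of the following holds: 1. $G$ contains $\mathcal{B}_\ell(20\max\{n_1,n_2\},20\max\{n_1,n_2\})$; 2. there exists a subgroup $T$ of $G$, of index dividing $2\cdot 48^2$, with the following properties: (a) if $\mathcal{L}(T)$ contains $\ell^k\mathfrak{sl}_2(\mathbb{Z}_\ell)\oplus \ell^k\mathfrak{sl}_2(\mathbb{Z}_\ell)$ for a certain integer $k\geq 0$, then $T$ contains $\mathcal{B}_\ell(p,p)$, where $p=2k+\max\{2k,8n_1,8n_2\}$; (b) for any $(t_1,t_2)$ in $T$, if both $[t_1]$ and $[t_2]$ are multiples of the identity, then they are equal.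
   Context: For a prime $\ell$ and a positive integer $s$, $\mathcal{B}_\ell(s)=\{x\in \operatorname{SL}_2(\mathbb{Z}_\ell) : x\equiv \operatorname{Id} \pmod{\ell^s}\}$, and $\mathcal{B}_\ell(0)=\operatorname{SL}_2(\mathbb{Z}_\ell)$; for non-negative integers $k_1,k_2$, $\mathcal{B}_\ell(k_1,k_2)=\mathcal{B}_\ell(k_1)\times\mathcal{B}_\ell(k_2)$. For $x\in\operatorname{GL}_2(\mathbb{Z}_\ell)$, $[x]$ denotes its image in $\operatorname{GL}_2(\mathbb{F}_\ell)$. $\mathfrak{sl}_2(\mathbb{Z}_\ell)$ is the set of trace-zero $2\times2$ matrices over $\mathbb{Z}_\ell$. For $\ell$ odd and a subgroup $T$ of $\operatorname{GL}_2(\mathbb{Z}_\ell)^2$, $\mathcal{L}(T)\subseteq\mathfrak{sl}_2(\mathbb{Z}_\ell)\oplus\mathfrak{sl}_2(\mathbb{Z}_\ell)$ is the $\mathbb{Z}_\ell$-span of $\Theta_2(T)$, where $\Theta_2(g_1,g_2)=\left(g_1-\tfrac12\operatorname{tr}(g_1)\operatorname{Id},\,g_2-\tfrac12\operatorname{tr}(g_2)\operatorname{Id}\right)$.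
   Formalization: "Open subgroup of GL_2(Z_ℓ)^2" is read as open in the subgroup of pairs with equal determinants, since no subgroup open in GL_2(Z_ℓ)^2 has det(g_1)=det(g_2) throughout. *)

theory Defs
  imports
    "HOL-Analysis.Analysis"
    "HOL-Algebra.Coset"
    "Berlekamp_Zassenhaus.Finite_Field"
begin

section \<open>The ring of \<open>\<ell>\<close>-adic integers\<close>

text \<open>
  The prime \<open>\<ell>\<close> is \<open>CARD('l)\<close> for a type \<open>'l\<close> of class \<open>prime_card\<close>. The ring \<open>\<int>\<^sub>\<ell>\<close> is the
  inverse limit of the rings \<open>\<int>/\<ell>\<^sup>n\<close>: an element is a compatible sequence of residues, the
  \<open>n\<close>-th one represented by an integer in \<open>{0..<\<ell>\<^sup>n}\<close>.
\<close>

typedef (overloaded) ('l :: prime_card) zp =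
  "{x :: nat \<Rightarrow> int. \<forall>n. x n \<in> {0..<int CARD('l) ^ n} \<and> x (Suc n) mod int CARD('l) ^ n = x n}"
  morphisms zp_res Abs_zp
  by (rule exI[of _ "\<lambda>_. 0"]) simp

setup_lifting type_definition_zp

lemma zp_eqI: "(\<And>n. zp_res x n = zp_res y n) \<Longrightarrow> x = y"
  by (simp add: zp_res_inject[symmetric] fun_eq_iff)

lemma mod_power_Suc_mod [simp]: "(a mod b ^ Suc n) mod b ^ n = a mod (b :: int) ^ n"
  by (rule mod_mod_cancel) simp

lemma mod_mult_power_mod [simp]: "(a mod (b * b ^ n)) mod b ^ n = a mod (b :: int) ^ n"
  by (rule mod_mod_cancel) simp

instantiation zp :: (prime_card) comm_ring_1
begin

lift_definition zero_zp :: "'a zp" is "\<lambda>n. 0" by simp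

lift_definition one_zp :: "'a zp" is "\<lambda>n. 1 mod int CARD('a) ^ n"
  by simp

lift_definition plus_zp :: "'a zp \<Rightarrow> 'a zp \<Rightarrow> 'a zp" is
  "\<lambda>x y n. (x n + y n) mod int CARD('a) ^ n"
  by (simp, metis mod_add_eq)

lift_definition uminus_zp :: "'a zp \<Rightarrow> 'a zp" is "\<lambda>x n. (- x n) mod int CARD('a) ^ n"
  by (simp, metis mod_minus_eq)

lift_definition minus_zp :: "'a zp \<Rightarrow> 'a zp \<Rightarrow> 'a zp" is
  "\<lambda>x y n. (x n - y n) mod int CARD('a) ^ n"
  by (simp, metis mod_diff_eq)

lift_definition times_zp :: "'a zp \<Rightarrow> 'a zp \<Rightarrow> 'a zp" is
  "\<lambda>x y n. (x n * y n) mod int CARD('a) ^ n"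
  by (simp, metis mod_mult_eq)

instance
proof
  show "(0 :: 'a zp) \<noteq> 1"
  proof
    assume "(0 :: 'a zp) = 1"
    then have "zp_res (0 :: 'a zp) 1 = zp_res (1 :: 'a zp) 1" by simp
    then show False
      using prime_card[where ?'a = 'a] prime_gt_1_nat[of "CARD('a)"]
      by (simp add: zero_zp.rep_eq one_zp.rep_eq)
  qed
qed (transfer; auto simp: fun_eq_iff mod_simps algebra_simps)+

end


lemma zp_res_mod:
  fixes x :: "'l :: prime_card zp"
  assumes "n \<le> m"
  shows "zp_res x m mod int CARD('l) ^ n = zp_res x n"
  using assms
proof (induction m rule: dec_induct)
  case base
  show ?case using zp_res[of x] by simp
next
  case (step m)
  have "zp_res x (Suc m) mod int CARD('l) ^ m = zp_res x m"
    using zp_res[of x] by blast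
  then have "zp_res x m mod int CARD('l) ^ n
      = zp_res x (Suc m) mod int CARD('l) ^ m mod int CARD('l) ^ n"
    by simp
  also have "\<dots> = zp_res x (Suc m) mod int CARD('l) ^ n"
    by (rule mod_mod_cancel) (simp add: step.hyps le_imp_power_dvd)
  finally show ?case using step.IH by simp
qed

lemma zp_res_cong:
  fixes x y :: "'l :: prime_card zp"
  assumes "n \<le> m" "zp_res x m = zp_res y m"
  shows "zp_res x n = zp_res y n"
  using zp_res_mod[OF assms(1), of x] zp_res_mod[OF assms(1), of y] assms(2) by simp

text \<open>The inverse limit topology, that is, the \<open>\<ell>\<close>-adic topology.\<close>

instantiation zp :: (prime_card) topological_space
begin

definition open_zp :: "'a zp set \<Rightarrow> bool" where
  "open_zp U \<longleftrightarrow> (\<forall>x\<in>U. \<exists>n. \<forall>y. zp_res y n = zp_res x n \<longrightarrow> y \<in> U)"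

instance
proof
  show "open (UNIV :: 'a zp set)" by (simp add: open_zp_def)
next
  fix S T :: "'a zp set"
  assume S: "open S" and T: "open T"
  show "open (S \<inter> T)"
    unfolding open_zp_def
  proof
    fix x assume "x \<in> S \<inter> T"
    then obtain m n where m: "\<And>y. zp_res y m = zp_res x m \<Longrightarrow> y \<in> S"
      and n: "\<And>y. zp_res y n = zp_res x n \<Longrightarrow> y \<in> T"
      using S T unfolding open_zp_def by (meson IntD1 IntD2)
    have "\<forall>y. zp_res y (max m n) = zp_res x (max m n) \<longrightarrow> y \<in> S \<inter> T"
      using m n zp_res_cong[of m "max m n"] zp_res_cong[of n "max m n"]
      by (metis IntI max.cobounded1 max.cobounded2)
    then show "\<exists>k. \<forall>y. zp_res y k = zp_res x k \<longrightarrow> y \<in> S \<inter> T" ..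
  qed
next
  fix K :: "'a zp set set"
  assume "\<forall>S\<in>K. open S"
  then show "open (\<Union>K)"
    unfolding open_zp_def by (meson UnionE UnionI)
qed

end

lemma zp_unit:
  fixes x :: "'l :: prime_card zp"
  assumes "coprime (zp_res x 1) (int CARD('l))"
  shows "\<exists>y. x * y = 1"
proof -
  let ?l = "int CARD('l)"
  have l0: "?l > 0" by simp
  have cop: "coprime (zp_res x n) (?l ^ n)" for n
  proof (cases "n = 0")
    case False
    then have "zp_res x n mod ?l = zp_res x 1"
      using zp_res_mod[of 1 n x] by simp
    then have "coprime (zp_res x n) ?l"
      using assms by (metis coprime_mod_left_iff l0 less_irrefl)
    then show ?thesis by simp
  qed simp
  define y where "y n = (SOME z. [zp_res x n * z = 1] (mod ?l ^ n)) mod ?l ^ n" for n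
  have y: "[zp_res x n * y n = 1] (mod ?l ^ n)" for n
  proof -
    have "\<exists>z. [zp_res x n * z = 1] (mod ?l ^ n)"
      using cong_solve_coprime_int[OF cop] by blast
    then have "[zp_res x n * (SOME z. [zp_res x n * z = 1] (mod ?l ^ n)) = 1] (mod ?l ^ n)"
      by (rule someI_ex)
    then show ?thesis unfolding y_def by (simp add: cong_def mod_mult_right_eq)
  qed
  have rng: "y n \<in> {0..<?l ^ n}" for n
    by (simp add: y_def)
  have comp: "y (Suc n) mod ?l ^ n = y n" for n
  proof -
    have "[zp_res x (Suc n) * y (Suc n) = 1] (mod ?l ^ n)"
      by (rule cong_modulus_mult[of _ _ _ ?l]) (use y[of "Suc n"] in \<open>simp add: mult.commute\<close>)
    moreover have "[zp_res x (Suc n) = zp_res x n] (mod ?l ^ n)"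
      using zp_res_mod[of n "Suc n" x] zp_res_mod[of n n x] by (simp add: cong_def)
    ultimately have "[zp_res x n * y (Suc n) = 1] (mod ?l ^ n)"
      by (meson cong_scalar_right cong_sym cong_trans)
    then have "[zp_res x n * y (Suc n) = zp_res x n * y n] (mod ?l ^ n)"
      using y[of n] by (meson cong_sym cong_trans)
    then have "[y (Suc n) = y n] (mod ?l ^ n)"
      using cop[of n] by (simp add: cong_mult_lcancel)
    then show ?thesis using rng[of n] by (simp add: cong_def)
  qed
  have "zp_res (Abs_zp y :: 'l zp) = y"
    by (rule Abs_zp_inverse) (use rng comp in simp)
  then have "x * Abs_zp y = 1"
    using y by (intro zp_eqI) (simp add: times_zp.rep_eq one_zp.rep_eq cong_def)
  then show ?thesis ..
qed

lemma zp_res_of_nat: "zp_res (of_nat m :: 'l :: prime_card zp) n = int m mod int CARD('l) ^ n"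
proof (induction m)
  case (Suc m)
  then show ?case by (simp add: plus_zp.rep_eq one_zp.rep_eq mod_simps)
qed (simp add: zero_zp.rep_eq)

text \<open>The element \<open>1/2\<close> of \<open>\<int>\<^sub>\<ell>\<close>, meaningful only for odd \<open>\<ell>\<close>.\<close>

definition half_zp :: "'l :: prime_card zp" where
  "half_zp = (THE h. 2 * h = 1)"

lemma two_half_zp:
  assumes "CARD('l :: prime_card) > 2"
  shows "2 * (half_zp :: 'l zp) = 1"
proof -
  have "prime CARD('l)" by (rule prime_card)
  then have "odd CARD('l)" using assms prime_odd_nat by blast
  then have "coprime (zp_res (2 :: 'l zp) 1) (int CARD('l))"
    using assms zp_res_of_nat[of 2 1, where ?'l = 'l] by simp
  then obtain h :: "'l zp" where h: "2 * h = 1" using zp_unit by blast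
  have "h' = h" if "2 * h' = 1" for h' :: "'l zp"
  proof -
    have "h' = h' * (2 * h)" using h by simp
    also have "\<dots> = (2 * h') * h" by (simp only: mult_ac)
    finally show ?thesis using that by simp
  qed
  then show ?thesis unfolding half_zp_def using h by (rule_tac theI)
qed

section \<open>Matrix groups over \<open>\<int>\<^sub>\<ell>\<close>\<close>

type_synonym 'l zp_mat = "'l zp ^ 2 ^ 2"

definition GL2 :: "('l :: prime_card zp_mat) monoid" where
  "GL2 = \<lparr>carrier = {A. invertible A}, mult = (**), one = mat 1\<rparr>"

lemma GL2_simps [simp]:
  "carrier GL2 = {A. invertible A}" "A \<otimes>\<^bsub>GL2\<^esub> B = A ** B" "\<one>\<^bsub>GL2\<^esub> = mat 1"
  by (simp_all add: GL2_def)

lemma group_GL2: "group (GL2 :: ('l :: prime_card zp_mat) monoid)"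
proof (rule groupI)
  fix A :: "'l zp_mat"
  assume "A \<in> carrier GL2"
  then obtain B where "A ** B = mat 1" "B ** A = mat 1"
    by (auto simp: invertible_def)
  then show "\<exists>B\<in>carrier GL2. B \<otimes>\<^bsub>GL2\<^esub> A = \<one>\<^bsub>GL2\<^esub>"
    by (auto simp: invertible_def)
next
  fix A B :: "'l zp_mat"
  assume "A \<in> carrier GL2" "B \<in> carrier GL2"
  then show "A \<otimes>\<^bsub>GL2\<^esub> B \<in> carrier GL2"
    by (simp add: invertible_mult)
next
  show "\<one>\<^bsub>GL2\<^esub> \<in> carrier (GL2 :: 'l zp_mat monoid)"
    by (auto simp: invertible_def)
qed (simp_all add: matrix_mul_assoc)

text \<open>For \<open>s = 0\<close> the congruence is void, so \<open>BB 0\<close> is all of \<open>SL\<^sub>2(\<int>\<^sub>\<ell>)\<close>.\<close>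

definition BB :: "nat \<Rightarrow> ('l :: prime_card zp_mat) set" where
  "BB s = {x. det x = 1 \<and> (\<forall>i j. of_nat CARD('l) ^ s dvd (x - mat 1) $ i $ j)}"

definition BB2 :: "nat \<Rightarrow> nat \<Rightarrow> ('l :: prime_card zp_mat \<times> 'l zp_mat) set" where
  "BB2 k1 k2 = BB k1 \<times> BB k2"

definition red_zp :: "'l :: prime_card zp \<Rightarrow> 'l mod_ring" where
  "red_zp x = of_int_mod_ring (zp_res x 1)"

definition red_mat :: "'l :: prime_card zp_mat \<Rightarrow> 'l mod_ring ^ 2 ^ 2" where
  "red_mat = map_matrix red_zp"

section \<open>The Lie algebra attached to a subgroup\<close>

definition sl2 :: "('l :: prime_card zp_mat) set" where
  "sl2 = {A. trace A = 0}"

definition smult_mat :: "'l :: prime_card zp \<Rightarrow> 'l zp_mat \<Rightarrow> 'l zp_mat" where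
  "smult_mat c = map_matrix ((*) c)"

definition smult_pair ::
    "'l :: prime_card zp \<Rightarrow> 'l zp_mat \<times> 'l zp_mat \<Rightarrow> 'l zp_mat \<times> 'l zp_mat" where
  "smult_pair c = map_prod (smult_mat c) (smult_mat c)"

global_interpretation zp_pair: Modules.module "smult_pair :: 'l :: prime_card zp \<Rightarrow> _"
  by standard
    (auto simp: smult_pair_def smult_mat_def map_matrix_def vec_eq_iff algebra_simps)

definition Theta :: "'l :: prime_card zp_mat \<Rightarrow> 'l zp_mat" where
  "Theta g = g - smult_mat (half_zp * trace g) (mat 1)"

definition Theta2 :: "'l :: prime_card zp_mat \<times> 'l zp_mat \<Rightarrow> 'l zp_mat \<times> 'l zp_mat" where
  "Theta2 = map_prod Theta Theta"

definition Lie_span :: "('l :: prime_card zp_mat \<times> 'l zp_mat) set \<Rightarrow> ('l zp_mat \<times> 'l zp_mat) set" where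
  "Lie_span T = zp_pair.span (Theta2 ` T)"

section \<open>The pairs with equal determinant\<close>

definition GL2_det_eq :: "('l :: prime_card zp_mat \<times> 'l zp_mat) set" where
  "GL2_det_eq = {(g1, g2) \<in> carrier (GL2 \<times>\<times> GL2). det g1 = det g2}"

text \<open>
  \<open>GL2_det_eq\<close> is the natural ambient group for a group \<open>G\<close> of pairs with equal determinant, and
  openness of \<open>G\<close> is to be understood in it: by the two lemmas below this is implied by openness
  in \<open>GL\<^sub>2(\<int>\<^sub>\<ell>)\<^sup>2\<close>, while a subgroup open in \<open>GL\<^sub>2(\<int>\<^sub>\<ell>)\<^sup>2\<close> always contains pairs with different
  determinants.
\<close>

lemma openin_GL2_imp_openin_det_eq:
  assumes "openin (top_of_set (carrier (GL2 \<times>\<times> GL2))) G" "G \<subseteq> GL2_det_eq"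
  shows "openin (top_of_set GL2_det_eq) G"
  using assms by (rule openin_subset_trans) (auto simp: GL2_det_eq_def)

lemma not_openin_GL2:
  fixes G :: "('l :: prime_card zp_mat \<times> 'l zp_mat) set"
  assumes G: "subgroup G (GL2 \<times>\<times> GL2)"
    and opn: "openin (top_of_set (carrier (GL2 \<times>\<times> GL2))) G"
    and det: "\<forall>(g1, g2)\<in>G. det g1 = det g2"
  shows False
proof -
  let ?l = "of_nat CARD('l) :: 'l zp"
  define u where "u k = 1 + ?l ^ Suc k" for k
  define A :: "nat \<Rightarrow> 'l zp_mat" where
    "A k = (\<chi> i j. if i = j then if i = 1 then u k else 1 else 0)" for k
  have u: "zp_res (u k) n = (1 + int CARD('l) ^ Suc k) mod int CARD('l) ^ n" for k n
    using zp_res_of_nat[of "1 + CARD('l) ^ Suc k" n, where ?'l = 'l]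
    by (simp add: u_def)
  have l2: "CARD('l) > 1" using prime_card[where ?'a = 'l] by (rule prime_gt_1_nat)
  have lim: "u \<longlonglongrightarrow> 1"
  proof (rule topological_tendstoI)
    fix S :: "'l zp set" assume "open S" "1 \<in> S"
    then obtain n where n: "\<And>y. zp_res y n = zp_res (1 :: 'l zp) n \<Longrightarrow> y \<in> S"
      unfolding open_zp_def by blast
    have "u k \<in> S" if "k \<ge> n" for k
    proof (rule n)
      have "int CARD('l) ^ n dvd int CARD('l) ^ Suc k"
        using that by (intro le_imp_power_dvd) simp
      then show "zp_res (u k) n = zp_res (1 :: 'l zp) n"
        unfolding u one_zp.rep_eq mod_eq_dvd_iff by simp
    qed
    then show "\<forall>\<^sub>F k in sequentially. u k \<in> S"
      by (auto simp: eventually_sequentially)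
  qed
  have "A \<longlonglongrightarrow> mat 1"
    proof (intro vec_tendstoI)
    fix i j :: 2
    show "(\<lambda>k. A k $ i $ j) \<longlonglongrightarrow> mat 1 $ i $ j"
      using lim by (cases "i = j"; cases "i = 1") (simp_all add: A_def mat_def)
  qed
  then have lim2: "(\<lambda>k. (A k, mat 1)) \<longlonglongrightarrow> (mat 1, mat 1 :: 'l zp_mat)"
    by (intro tendsto_Pair tendsto_const)
  obtain U where U: "open U" "G = carrier (GL2 \<times>\<times> GL2) \<inter> U"
    using opn by (auto simp: openin_open)
  have "(mat 1, mat 1) \<in> G" using subgroup.one_closed[OF G] by simp
  then have "(mat 1, mat 1) \<in> U" using U by blast
  then obtain k where k: "(A k, mat 1) \<in> U"
    using topological_tendstoD[OF lim2 U(1)] by (auto simp: eventually_sequentially)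
  have "zp_res (u k) 1 = 1" unfolding u using l2 by simp
  then obtain v where v: "u k * v = 1" using zp_unit[of "u k"] by auto
  define B :: "'l zp_mat" where
    "B = (\<chi> i j. if i = j then if i = 1 then v else 1 else 0)"
  have "A k ** B = mat 1" "B ** A k = mat 1"
    using v by (simp_all add: A_def B_def matrix_matrix_mult_def vec_eq_iff mat_def forall_2 sum_2 mult.commute)
  then have "invertible (A k)" by (auto simp: invertible_def)
  moreover have "invertible (mat 1 :: 'l zp_mat)" by (auto simp: invertible_def)
  ultimately have "(A k, mat 1) \<in> G" using U k by simp
  then have "det (A k) = 1" using det by auto
  then have "u k = 1" by (simp add: det_2 A_def)
  then have "zp_res (u k) (Suc (Suc k)) = zp_res (1 :: 'l zp) (Suc (Suc k))" by simp
  then have "(1 + int CARD('l) ^ Suc k) mod int CARD('l) ^ Suc (Suc k)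
      = 1 mod int CARD('l) ^ Suc (Suc k)"
    unfolding u one_zp.rep_eq .
  then have "int CARD('l) ^ Suc (Suc k) dvd int CARD('l) ^ Suc k"
    unfolding mod_eq_dvd_iff by simp
  then show False using l2 power_dvd_imp_le[of "CARD('l)" "Suc (Suc k)" "Suc k"]
    by (simp flip: of_nat_power)
qed

end

theory Submission
  imports Defs
begin

text \<open>
  Put \<open>n = max n1 n2\<close> and write \<open>B(s)\<close> for \<open>BB s\<close>. The proof measures how far the two coordinates of
  \<open>G\<close> are from having equal traces up to sign. Let \<open>r\<close> be the minimal valuation of
  \<open>tr(g\<^sub>1)\<^sup>2 - tr(g\<^sub>2)\<^sup>2\<close> over \<open>(g\<^sub>1, g\<^sub>2) \<in> G\<close>; it is finite because \<open>G\<close> is open.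

  A discrepancy of valuation \<open>r\<close> forces \<open>G\<close> to contain \<open>B(m) \<times> B(m)\<close> with \<open>m = 2 r + 5 n + 1\<close>
  (\<open>contains_BB2_of_discrepancy\<close>). Indeed the leading terms \<open>(u, v)\<close> of the elements
  \<open>(1 + \<ell>\<^sup>s u, 1 + \<ell>\<^sup>s\<^sup>+\<^sup>n v)\<close> of \<open>G\<close> form a module that is stable under conjugation by \<open>g\<close>.
  On trace-zero matrices orthogonal to \<open>g\<close>, the sum of \<open>Ad g\<close> and its inverse is a scalar
  that depends only on the squared trace and the determinant of \<open>g\<close>. A discrepancy
  therefore allows one to kill \<open>u\<close> and keep \<open>v\<close>, which gives an element \<open>(1, y)\<close> of \<open>G\<close> with \<open>y\<close>
  nontrivial at a controlled level (\<open>kernel_element\<close>). Double commutators with \<open>B(n)\<close> then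
  generate a whole congruence subgroup (\<open>kernel_contains_BB\<close>), and the roles of the two coordinates can be
  exchanged. Corrections are possible because any element of \<open>B(s + n)\<close> can be completed by an element of
  \<open>B(s)\<close> to a member of \<open>G\<close> (\<open>lift1\<close>, \<open>lift2\<close>).

  If \<open>m \<le> 20 n\<close>, the first alternative holds. Otherwise \<open>2 r \<ge> 15 n\<close>, and the traces agree up to sign
  to high precision. The sign is a character of \<open>G\<close> (\<open>sign_exists\<close>, \<open>sign_cong_mult\<close>); let
  \<open>T\<close> be its kernel, of index 1 or 2. On \<open>T\<close> the traces agree modulo
  \<open>\<ell>\<^sup>r\<^sup>-\<^sup>n\<close>. This gives (b), since half the trace of a scalar matrix is the scalar.
  For \<open>(x, y) \<in> T\<close> the functional \<open>(u, v) \<mapsto> tr(x u) - tr(y v)\<close> vanishes modulo the same power on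
  \<open>Lie_span T\<close>, and taking \<open>x\<close> unipotent of level \<open>n\<close> shows that
  \<open>\<ell>\<^sup>k sl\<^sub>2 \<oplus> \<ell>\<^sup>k sl\<^sub>2\<close> can be contained in \<open>Lie_span T\<close> only if \<open>r \<le> k + 2 n\<close>
  (\<open>Lie_span_T_bound\<close>). Then \<open>m \<le> 4 k \<le> p\<close>, which gives (a).
\<close>

section \<open>Divisibility in \<open>\<int>\<^sub>\<ell>\<close>\<close>

abbreviation ell :: "'l :: prime_card zp" where
  "ell \<equiv> of_nat CARD('l)"

lemma CARD_gt_1: "CARD('l :: prime_card) > 1"
  using prime_card[where ?'a = 'l] by (rule prime_gt_1_nat)

lemma zp_res_bounds:
  fixes x :: "'l :: prime_card zp"
  shows "0 \<le> zp_res x n" "zp_res x n < int CARD('l) ^ n"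
proof -
  have "zp_res x n \<in> {0..<int CARD('l) ^ n}" using zp_res[of x] by blast
  then show "0 \<le> zp_res x n" "zp_res x n < int CARD('l) ^ n" by simp_all
qed

lemma zp_res_ell_power:
  "zp_res (ell ^ m :: 'l :: prime_card zp) n = int CARD('l) ^ m mod int CARD('l) ^ n"
  using zp_res_of_nat[of "CARD('l) ^ m" n, where ?'l = 'l] by simp

text \<open>The quotient by \<open>\<ell>\<^sup>m\<close> is found by dividing residues, shifted by \<open>m\<close> places so that no precision
  is lost.\<close>

lemma ell_power_dvd_iff:
  fixes x :: "'l :: prime_card zp"
  shows "ell ^ m dvd x \<longleftrightarrow> zp_res x m = 0"
proof
  assume "ell ^ m dvd x"
  then obtain z where z: "x = ell ^ m * z" by (elim dvdE)
  show "zp_res x m = 0"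
    unfolding z times_zp.rep_eq zp_res_ell_power by simp
next
  assume x0: "zp_res x m = 0"
  let ?l = "int CARD('l)"
  define z where "z n = zp_res x (n + m) div ?l ^ m" for n
  have dv: "?l ^ m dvd zp_res x (n + m)" for n
    using zp_res_mod[of m "n + m" x] x0 by (simp add: dvd_eq_mod_eq_0)
  have mz: "?l ^ m * z n = zp_res x (n + m)" for n
    using dv[of n] by (simp add: z_def)
  have "zp_res x (n + m) < ?l ^ m * ?l ^ n" for n
    using zp_res_bounds(2)[of x "n + m"] by (simp add: power_add mult.commute)
  then have zlt: "z n < ?l ^ n" for n
    unfolding mz[symmetric] by (simp add: mult_less_cancel_left_pos)
  have z0: "0 \<le> z n" for n
    unfolding z_def by (rule pos_imp_zdiv_nonneg_iff[THEN iffD2]) (simp_all add: zp_res_bounds)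
  have zS: "z (Suc n) mod ?l ^ n = z n" for n
  proof -
    have "?l ^ m * (z (Suc n) mod ?l ^ n) = ?l ^ m * z (Suc n) mod (?l ^ m * ?l ^ n)"
      by (rule mult_mod_right)
    also have "\<dots> = zp_res x (Suc n + m) mod ?l ^ (n + m)"
      by (simp only: mz power_add mult.commute[of "?l ^ n"])
    also have "\<dots> = ?l ^ m * z n"
      using zp_res_mod[of "n + m" "Suc n + m" x] by (simp add: mz)
    finally show ?thesis by simp
  qed
  have rz: "zp_res (Abs_zp z :: 'l zp) = z"
    by (rule Abs_zp_inverse) (use zlt z0 zS in auto)
  have "x = ell ^ m * Abs_zp z"
  proof (rule zp_eqI)
    fix n
    have "zp_res (ell ^ m * Abs_zp z :: 'l zp) n = zp_res x (n + m) mod ?l ^ n"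
      unfolding times_zp.rep_eq zp_res_ell_power rz by (simp add: mod_mult_left_eq mz)
    then show "zp_res x n = zp_res (ell ^ m * Abs_zp z :: 'l zp) n"
      using zp_res_mod[of n "n + m" x] by simp
  qed
  then show "ell ^ m dvd x" by simp
qed

lemma zp_eq_0_iff:
  fixes x :: "'l :: prime_card zp"
  shows "x = 0 \<longleftrightarrow> (\<forall>m. ell ^ m dvd x)"
  by (auto simp: ell_power_dvd_iff zero_zp.rep_eq intro: zp_eqI)

lemma ell_dvd_iff: "(ell :: 'l :: prime_card zp) dvd x \<longleftrightarrow> zp_res x 1 = 0"
  using ell_power_dvd_iff[of 1 x] by simp

lemma not_ell_dvd_1: "\<not> (ell :: 'l :: prime_card zp) dvd 1"
  using CARD_gt_1[where ?'l = 'l] by (simp add: ell_dvd_iff one_zp.rep_eq)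

lemma is_unit_zp_iff:
  fixes x :: "'l :: prime_card zp"
  shows "x dvd 1 \<longleftrightarrow> \<not> ell dvd x"
proof
  show "x dvd 1 \<Longrightarrow> \<not> ell dvd x"
    using not_ell_dvd_1 dvd_trans by blast
next
  assume "\<not> ell dvd x"
  then have "\<not> int CARD('l) dvd zp_res x 1"
    using zp_res_bounds[of x 1] by (auto simp: ell_dvd_iff dest: zdvd_imp_le)
  then have "coprime (zp_res x 1) (int CARD('l))"
    using prime_card[where ?'a = 'l]
    by (metis prime_imp_coprime coprime_commute prime_nat_int_transfer)
  then show "x dvd 1" using zp_unit by (metis dvdI)
qed

lemma ell_times_eq_0:
  fixes x :: "'l :: prime_card zp"
  assumes "ell * x = 0"
  shows "x = 0"
proof (rule zp_eqI)
  fix n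
  let ?l = "int CARD('l)"
  have "zp_res (ell * x) (Suc n) = 0" using assms by (simp add: zero_zp.rep_eq)
  then have "(?l * zp_res x (Suc n)) mod ?l ^ Suc n = 0"
    using zp_res_ell_power[of 1 "Suc n", where ?'l = 'l]
    by (simp add: times_zp.rep_eq mod_mult_left_eq)
  then have "?l ^ n dvd zp_res x (Suc n)"
    by (simp add: mod_eq_0_iff_dvd)
  then show "zp_res x n = zp_res 0 n"
    using zp_res_mod[of n "Suc n" x] by (simp add: zero_zp.rep_eq)
qed

lemma ell_power_times_eq_0:
  "(ell :: 'l :: prime_card zp) ^ m * x = 0 \<Longrightarrow> x = 0"
  by (induction m) (auto simp: mult.assoc dest: ell_times_eq_0)

text \<open>Every nonzero element is a unit times a power of \<open>\<ell>\<close>; all the arithmetic of \<open>\<int>\<^sub>\<ell>\<close> below rests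
  on this.\<close>

lemma zp_factor:
  fixes x :: "'l :: prime_card zp"
  assumes "x \<noteq> 0"
  obtains a u where "x = ell ^ a * u" "\<not> ell dvd u"
proof -
  obtain m where m: "\<not> ell ^ m dvd x" using assms zp_eq_0_iff by blast
  define a where "a = (LEAST m. \<not> ell ^ Suc m dvd x)"
  have "\<not> ell ^ Suc m dvd x" using m by (meson dvd_trans le_imp_power_dvd le_SucI order_refl)
  then have a1: "\<not> ell ^ Suc a dvd x" unfolding a_def by (rule LeastI)
  have "ell ^ a dvd x"
    using not_less_Least[of "a - 1" "\<lambda>m. \<not> ell ^ Suc m dvd x"] by (cases a) (auto simp: a_def)
  then obtain u where u: "x = ell ^ a * u" by (elim dvdE)
  have "\<not> ell dvd u" using a1 unfolding u power_Suc2 by (meson dvd_refl mult_dvd_mono)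
  with u that show ?thesis by blast
qed

instance zp :: (prime_card) idom
proof
  fix x y :: "'a zp"
  assume "x \<noteq> 0" "y \<noteq> 0"
  then obtain a b u v where *: "x = ell ^ a * u" "y = ell ^ b * v" "\<not> ell dvd u" "\<not> ell dvd v"
    by (metis zp_factor)
  show "x * y \<noteq> 0"
  proof
    assume "x * y = 0"
    then have "ell ^ (a + b) * (u * v) = 0" by (simp add: * power_add mult_ac)
    then have "u * v = 0" by (rule ell_power_times_eq_0)
    moreover have "u dvd 1" "v dvd 1" using * by (simp_all add: is_unit_zp_iff)
    then have "u * v dvd 1" using mult_dvd_mono[of u 1 v 1] by simp
    ultimately show False by simp
  qed
qed

lemma ell_nonzero [simp]: "(ell :: 'l :: prime_card zp) \<noteq> 0"
  using not_ell_dvd_1 ell_times_eq_0 by (metis mult_zero_right zero_neq_one mult_zero_left)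

lemma ell_power_cancel [simp]:
  "(ell :: 'l :: prime_card zp) ^ a * x dvd ell ^ a * y \<longleftrightarrow> x dvd y"
  by (simp del: of_nat_power)

lemma ell_dvd_mult_iff:
  fixes x y :: "'l :: prime_card zp"
  shows "ell dvd x * y \<longleftrightarrow> ell dvd x \<or> ell dvd y"
  by (metis is_unit_mult_iff is_unit_zp_iff dvd_mult dvd_mult2)

lemma ell_power_mono: "a \<le> b \<Longrightarrow> (ell :: 'l :: prime_card zp) ^ b dvd x \<Longrightarrow> ell ^ a dvd x"
  by (meson dvd_trans le_imp_power_dvd)

lemma ell_power_le_of_dvd:
  assumes "(ell :: 'l :: prime_card zp) ^ a dvd ell ^ b * u" "\<not> ell dvd u"
  shows "a \<le> b"
proof (rule ccontr)
  assume "\<not> a \<le> b"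
  then have "ell ^ (b + 1) dvd ell ^ b * u" by (intro ell_power_mono[OF _ assms(1)]) simp
  then have "ell ^ b * ell dvd ell ^ b * u" by (simp only: Suc_eq_plus1[symmetric] power_Suc2)
  then show False using assms(2) by (simp only: ell_power_cancel)
qed

lemma ell_power_dvd_cancel:
  fixes x y :: "'l :: prime_card zp"
  assumes "ell ^ r dvd x * y" "\<not> ell ^ Suc a dvd x"
  shows "ell ^ (r - a) dvd y"
proof -
  have "x \<noteq> 0" using assms(2) by auto
  then obtain b u where bu: "x = ell ^ b * u" "\<not> ell dvd u" by (rule zp_factor)
  have "\<not> Suc a \<le> b" using assms(2) by (auto simp: bu intro: le_imp_power_dvd dvd_mult2 simp del: power_Suc)
  then have ba: "b \<le> a" by simp
  obtain v where v: "u * v = 1" using bu(2) is_unit_zp_iff by (metis dvdE)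
  have "ell ^ r dvd x * y * v" using assms(1) by simp
  also have "x * y * v = ell ^ b * y" using v by (simp add: bu mult_ac)
  finally have *: "ell ^ r dvd ell ^ b * y" .
  show ?thesis
  proof (cases "b \<le> r")
    case True
    then have "ell ^ b * ell ^ (r - b) dvd ell ^ b * y"
      using * by (metis le_add_diff_inverse power_add)
    then show ?thesis using ba by (auto intro: ell_power_mono[of "r - a" "r - b"] simp only: ell_power_cancel)
  qed (use ba in simp)
qed

lemma ell_power_dvd_cancel_unit:
  fixes x y :: "'l :: prime_card zp"
  assumes "ell ^ r dvd x * y" "\<not> ell dvd x"
  shows "ell ^ r dvd y"
  using ell_power_dvd_cancel[of r x y 0] assms by simp

lemma zp_approx_nat:
  fixes x :: "'l :: prime_card zp"
  obtains c :: nat where "ell ^ m dvd x - of_nat c"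
proof -
  have "zp_res (x - of_nat (nat (zp_res x m))) m = 0"
    using zp_res_bounds[of x m] unfolding minus_zp.rep_eq zp_res_of_nat by simp
  with that show ?thesis by (simp add: ell_power_dvd_iff)
qed

lemma zp_dvd_linear: "(x :: 'l :: prime_card zp) dvd y \<or> y dvd x"
proof (cases "x = 0 \<or> y = 0")
  case False
  then obtain a b u v where *: "x = ell ^ a * u" "y = ell ^ b * v" "\<not> ell dvd u" "\<not> ell dvd v"
    by (metis zp_factor)
  have "u dvd w" "v dvd w" for w using * is_unit_zp_iff by (meson dvd_trans one_dvd)+
  then show ?thesis unfolding * by (metis mult_dvd_mono le_imp_power_dvd nle_le)
qed auto

text \<open>Two linear equations in three unknowns have a solution with a unit among its entries: of any
  two elements of \<open>\<int>\<^sub>\<ell>\<close> one divides the other, so the elimination needs no denominators.\<close>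

lemma primitive_solution_1:
  fixes a b :: "'l :: prime_card zp"
  obtains x y where "a * x + b * y = 0" "\<not> ell dvd x \<or> \<not> ell dvd y"
proof (cases "a dvd b")
  case True
  then obtain q where "b = a * q" by (elim dvdE)
  then show ?thesis by (intro that[of "- q" 1]) (simp_all add: not_ell_dvd_1)
next
  case False
  then obtain q where "a = b * q" using zp_dvd_linear by (metis dvdE)
  then show ?thesis by (intro that[of 1 "- q"]) (simp_all add: not_ell_dvd_1)
qed

lemma primitive_solution_2:
  fixes a1 a2 a3 b1 b2 b3 :: "'l :: prime_card zp"
  obtains x y z where "a1 * x + a2 * y + a3 * z = 0" "b1 * x + b2 * y + b3 * z = 0"
    "\<not> ell dvd x \<or> \<not> ell dvd y \<or> \<not> ell dvd z"
proof -
  \<comment> \<open>the case in which the first coefficient divides the other two; the rest follows by symmetry\<close>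
  have main: "\<exists>x y z. a1 * x + a2 * y + a3 * z = 0 \<and> b1 * x + b2 * y + b3 * z = 0 \<and>
      (\<not> ell dvd x \<or> \<not> ell dvd y \<or> \<not> ell dvd z)"
    if dv: "a1 dvd a2" "a1 dvd a3" for a1 a2 a3 b1 b2 b3 :: "'l zp"
  proof -
    obtain p q where pq: "a2 = a1 * p" "a3 = a1 * q" using dv by (elim dvdE)
    obtain y z where yz: "(b2 - b1 * p) * y + (b3 - b1 * q) * z = 0" "\<not> ell dvd y \<or> \<not> ell dvd z"
      by (rule primitive_solution_1)
    have "b1 * (- p * y - q * z) + b2 * y + b3 * z = 0"
      using yz(1) by (simp add: algebra_simps)
    moreover have "a1 * (- p * y - q * z) + a2 * y + a3 * z = 0"
      by (simp add: pq algebra_simps)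
    ultimately show ?thesis using yz(2) by blast
  qed
  consider "a1 dvd a2" "a1 dvd a3" | "a2 dvd a1" "a2 dvd a3" | "a3 dvd a1" "a3 dvd a2"
    using zp_dvd_linear[of a1 a2] zp_dvd_linear[of a1 a3] zp_dvd_linear[of a2 a3] dvd_trans by blast
  then show ?thesis
  proof cases
    case 1
    then show ?thesis using main[of a1 a2 a3 b1 b2 b3] that by blast
  next
    case 2
    then obtain x y z where "a2 * x + a1 * y + a3 * z = 0" "b2 * x + b1 * y + b3 * z = 0"
      "\<not> ell dvd x \<or> \<not> ell dvd y \<or> \<not> ell dvd z"
      using main[of a2 a1 a3 b2 b1 b3] by blast
    then show ?thesis by (intro that[of y x z]) (auto simp: add_ac)
  next
    case 3
    then obtain x y z where "a3 * x + a1 * y + a2 * z = 0" "b3 * x + b1 * y + b2 * z = 0"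
      "\<not> ell dvd x \<or> \<not> ell dvd y \<or> \<not> ell dvd z"
      using main[of a3 a1 a2 b3 b1 b2] by blast
    then show ?thesis by (intro that[of y z x]) (auto simp: add_ac)
  qed
qed

lemma ell_dvd_of_nat_iff: "(ell :: 'l :: prime_card zp) dvd of_nat m \<longleftrightarrow> CARD('l) dvd m"
  using zp_res_of_nat[of m 1, where ?'l = 'l] by (simp add: ell_dvd_iff flip: of_nat_mod dvd_eq_mod_eq_0)

lemma not_ell_dvd_2:
  assumes "CARD('l :: prime_card) > 2"
  shows "\<not> (ell :: 'l zp) dvd 2"
  using ell_dvd_of_nat_iff[of 2, where ?'l = 'l] assms by (auto dest: dvd_imp_le)

section \<open>Congruences between \<open>2 \<times> 2\<close> matrices\<close>

definition mat2 :: "'a \<Rightarrow> 'a \<Rightarrow> 'a \<Rightarrow> 'a \<Rightarrow> 'a :: zero ^ 2 ^ 2" where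
  "mat2 a b c d = vector [vector [a, b], vector [c, d]]"

lemma mat2_nth [simp]:
  "mat2 a b c d $ 1 $ 1 = a" "mat2 a b c d $ 1 $ 2 = b"
  "mat2 a b c d $ 2 $ 1 = c" "mat2 a b c d $ 2 $ 2 = d"
  by (simp_all add: mat2_def)

lemma mat_eq_iff_entries:
  "A = (B :: 'a ^ 2 ^ 2) \<longleftrightarrow> A $ 1 $ 1 = B $ 1 $ 1 \<and> A $ 1 $ 2 = B $ 1 $ 2 \<and>
    A $ 2 $ 1 = B $ 2 $ 1 \<and> A $ 2 $ 2 = B $ 2 $ 2"
  by (auto simp: vec_eq_iff forall_2)

lemma matrix_mult_nth_2:
  fixes A B :: "'a :: comm_ring_1 ^ 2 ^ 2"
  shows "(A ** B) $ i $ j = A $ i $ 1 * B $ 1 $ j + A $ i $ 2 * B $ 2 $ j"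
  by (simp add: matrix_matrix_mult_def sum_2)

lemma smult_mat_nth [simp]: "smult_mat c A $ i $ j = c * A $ i $ j"
  by (simp add: smult_mat_def map_matrix_def)

lemma trace_2: "trace (A :: 'a :: comm_ring_1 ^ 2 ^ 2) = A $ 1 $ 1 + A $ 2 $ 2"
  by (simp add: trace_def sum_2)

lemma mat_nth_2 [simp]:
  "(mat c :: 'a :: zero ^ 2 ^ 2) $ 1 $ 1 = c" "(mat c :: 'a ^ 2 ^ 2) $ 1 $ 2 = 0"
  "(mat c :: 'a ^ 2 ^ 2) $ 2 $ 1 = 0" "(mat c :: 'a ^ 2 ^ 2) $ 2 $ 2 = c"
  by (simp_all add: mat_def)

lemmas entries = mat_eq_iff_entries matrix_mult_nth_2 trace_2 det_2

definition mcong :: "nat \<Rightarrow> 'l :: prime_card zp_mat \<Rightarrow> 'l zp_mat \<Rightarrow> bool" where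
  "mcong m A B \<longleftrightarrow> (\<forall>i j. ell ^ m dvd A $ i $ j - B $ i $ j)"

lemma mcong_refl [simp]: "mcong m A A"
  by (simp add: mcong_def)

lemma mcong_sym: "mcong m A B \<Longrightarrow> mcong m B A"
  unfolding mcong_def by (metis dvd_minus_iff minus_diff_eq)

lemma mcong_trans [trans]: "mcong m A B \<Longrightarrow> mcong m B C \<Longrightarrow> mcong m A C"
  unfolding mcong_def by (metis diff_add_cancel add_diff_eq dvd_add)

lemma mcong_mono: "a \<le> b \<Longrightarrow> mcong b A B \<Longrightarrow> mcong a A B"
  unfolding mcong_def using ell_power_mono by blast

lemma mcong_iff_ex: "mcong m A B \<longleftrightarrow> (\<exists>Q. A = B + smult_mat (ell ^ m) Q)"
proof
  assume "mcong m A B"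
  then have "\<forall>i. \<forall>j. \<exists>q. A $ i $ j - B $ i $ j = ell ^ m * q"
    unfolding mcong_def dvd_def by blast
  then obtain q where "\<And>i j. A $ i $ j - B $ i $ j = ell ^ m * q i j" by metis
  then have "A = B + smult_mat (ell ^ m) (\<chi> i j. q i j)"
    by (simp add: vec_eq_iff algebra_simps)
  then show "\<exists>Q. A = B + smult_mat (ell ^ m) Q" ..
qed (auto simp: mcong_def)

lemma mcong_add: "mcong m A B \<Longrightarrow> mcong m C D \<Longrightarrow> mcong m (A + C) (B + D)"
  unfolding mcong_def by (simp add: add_diff_add dvd_add)

lemma mcong_diff: "mcong m A B \<Longrightarrow> mcong m C D \<Longrightarrow> mcong m (A - C) (B - D)"
  using dvd_diff[of "ell ^ m" "A $ i $ j - B $ i $ j" "C $ i $ j - D $ i $ j" for i j]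
  unfolding mcong_def by (simp add: algebra_simps)

lemma mcong_smult_ell: "mcong m A B \<Longrightarrow> mcong (k + m) (smult_mat (ell ^ k) A) (smult_mat (ell ^ k) B)"
  unfolding mcong_def by (simp add: power_add flip: right_diff_distrib)

lemma mcong_scalar: "ell ^ m dvd c - d \<Longrightarrow> mcong m (smult_mat c A) (smult_mat d A)"
  unfolding mcong_def by (simp flip: left_diff_distrib)

lemma mcong_mult:
  assumes "mcong m A B" "mcong m C D"
  shows "mcong m (A ** C) (B ** D)"
  unfolding mcong_def
proof (intro allI)
  fix i j
  have "(A ** C) $ i $ j - (B ** D) $ i $ j
      = (A $ i $ 1 - B $ i $ 1) * C $ 1 $ j + B $ i $ 1 * (C $ 1 $ j - D $ 1 $ j)
      + ((A $ i $ 2 - B $ i $ 2) * C $ 2 $ j + B $ i $ 2 * (C $ 2 $ j - D $ 2 $ j))"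
    by (simp add: matrix_mult_nth_2 algebra_simps)
  also have "ell ^ m dvd \<dots>"
    using assms unfolding mcong_def by (intro dvd_add dvd_mult dvd_mult2) auto
  finally show "ell ^ m dvd (A ** C) $ i $ j - (B ** D) $ i $ j" .
qed

lemma mcong_trace: "mcong m A B \<Longrightarrow> ell ^ m dvd trace A - trace B"
  unfolding mcong_def trace_2 by (metis add_diff_add dvd_add)

lemma mcong_cancel_left:
  assumes "P ** Q = mat 1" "mcong m (Q ** A) (Q ** B)"
  shows "mcong m A B"
proof -
  have "mcong m (P ** (Q ** A)) (P ** (Q ** B))" by (rule mcong_mult[OF mcong_refl assms(2)])
  then show ?thesis using assms(1) by (simp add: matrix_mul_assoc)
qed

lemma BB_iff: "x \<in> BB s \<longleftrightarrow> det x = 1 \<and> mcong s x (mat 1)"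
  by (simp add: BB_def mcong_def)

lemma BB_antimono: "a \<le> b \<Longrightarrow> BB b \<subseteq> BB a"
  by (auto simp: BB_iff intro: mcong_mono)

text \<open>The adjugate. It inverts matrices of determinant 1, and being affine in the matrix it turns
  statements about inverses into linear ones.\<close>

definition adj2 :: "'l :: prime_card zp_mat \<Rightarrow> 'l zp_mat" where
  "adj2 A = smult_mat (trace A) (mat 1) - A"

lemma adj2_mult:
  "A ** adj2 A = smult_mat (det A) (mat 1)" "adj2 A ** A = smult_mat (det A) (mat 1)"
  by (simp_all add: adj2_def entries algebra_simps)

lemma smult_mat_1 [simp]: "smult_mat 1 A = A"
  by (simp add: entries)

lemma smult_mat_smult [simp]: "smult_mat a (smult_mat b A) = smult_mat (a * b) A"
  by (simp add: entries mult.assoc)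

lemma smult_mat_mult [simp]:
  "smult_mat c A ** B = smult_mat c (A ** B)" "A ** smult_mat c B = smult_mat c (A ** B)"
  by (simp_all add: entries algebra_simps)

lemma smult_mat_add: "smult_mat c (A + B) = smult_mat c A + smult_mat c B"
  by (simp add: entries algebra_simps)

lemma adj2_mult_det_1:
  assumes "det A = 1"
  shows "A ** adj2 A = mat 1" "adj2 A ** A = mat 1"
  using assms by (simp_all add: adj2_mult)

lemma det_adj2 [simp]: "det (adj2 A) = det A"
  by (simp add: adj2_def entries algebra_simps)

lemma trace_adj2 [simp]: "trace (adj2 A) = trace A"
  by (simp add: adj2_def entries)

lemma mcong_adj2: "mcong m A B \<Longrightarrow> mcong m (adj2 A) (adj2 B)"
  unfolding adj2_def by (intro mcong_diff mcong_scalar mcong_trace)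

lemma adj2_mat_1 [simp]: "adj2 (mat 1) = mat 1"
  by (simp add: adj2_def entries)

lemma trace_mult_adj2: "trace (A ** B) + trace (A ** adj2 B) = trace A * trace B"
  by (simp add: adj2_def entries algebra_simps)

text \<open>A congruence \<open>mcong (i + k) A (lev i u)\<close> says that \<open>u\<close> is the leading term of \<open>A\<close> at level
  \<open>i\<close>, known modulo \<open>\<ell>\<^sup>k\<close>. As long as \<open>k \<le> i\<close>, products of matrices add their leading terms.\<close>

definition lev :: "nat \<Rightarrow> 'l :: prime_card zp_mat \<Rightarrow> 'l zp_mat" where
  "lev i u = mat 1 + smult_mat (ell ^ i) u"

lemma lev_0 [simp]: "lev i 0 = mat 1"
  by (simp add: lev_def entries)

lemma lev_cong: "mcong k u v \<Longrightarrow> mcong (i + k) (lev i u) (lev i v)"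
  unfolding lev_def by (intro mcong_add mcong_smult_ell) auto

lemma mcong_1_iff_lev: "mcong i A (mat 1) \<longleftrightarrow> (\<exists>u. A = lev i u)"
  by (simp add: mcong_iff_ex lev_def)

lemma lev_mult:
  assumes "k \<le> i"
  shows "mcong (i + k) (lev i u ** lev i v) (lev i (u + v))"
proof -
  have "lev i u ** lev i v = lev i (u + v) + smult_mat (ell ^ (i + i)) (u ** v)"
    by (simp add: lev_def entries power_add algebra_simps)
  then have "mcong (i + i) (lev i u ** lev i v) (lev i (u + v))"
    unfolding mcong_iff_ex by blast
  then show ?thesis by (rule mcong_mono[rotated]) (use assms in simp)
qed

lemma leading_mult:
  assumes "k \<le> i" "mcong (i + k) A (lev i u)" "mcong (i + k) B (lev i v)"
  shows "mcong (i + k) (A ** B) (lev i (u + v))"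
  using mcong_mult[OF assms(2,3)] lev_mult[OF assms(1)] by (rule mcong_trans)

lemma leading_conj:
  assumes "mcong (i + k) A (lev i u)" "g ** h = mat 1"
  shows "mcong (i + k) (g ** A ** h) (lev i (g ** u ** h))"
proof -
  have "g ** lev i u ** h = smult_mat 1 (g ** h) + smult_mat (ell ^ i) (g ** u ** h)"
    by (simp add: lev_def entries algebra_simps)
  then have "g ** lev i u ** h = lev i (g ** u ** h)"
    using assms(2) by (simp add: lev_def)
  then show ?thesis
    using mcong_mult[OF mcong_mult[OF mcong_refl[of _ g] assms(1)] mcong_refl[of _ h]] by simp
qed

lemma mcong_lev_imp_1: "mcong (i + k) A (lev i u) \<Longrightarrow> mcong i A (mat 1)"
  by (rule mcong_trans[OF mcong_mono[of i "i + k"]]) (auto simp: mcong_1_iff_lev)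

subsection \<open>Powers\<close>

primrec mpow :: "'l :: prime_card zp_mat \<Rightarrow> nat \<Rightarrow> 'l zp_mat" where
  "mpow A 0 = mat 1"
| "mpow A (Suc m) = A ** mpow A m"

lemma mpow_add: "mpow A (a + b) = mpow A a ** mpow A b"
  by (induction a) (simp_all add: matrix_mul_assoc)

lemma mpow_mult: "mpow A (a * b) = mpow (mpow A a) b"
  by (induction b) (simp_all add: mpow_add)

lemma mpow_1 [simp]: "mpow (mat 1) m = mat 1"
  by (induction m) simp_all

lemma det_mpow: "det (mpow A m) = det A ^ m"
  by (induction m) (simp_all add: det_mul)

lemma mcong_mpow: "mcong k A B \<Longrightarrow> mcong k (mpow A m) (mpow B m)"
  by (induction m) (auto intro: mcong_mult)

lemma mpow_lev:
  "mcong (3 * i) (mpow (lev i u) m)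
    (mat 1 + smult_mat (ell ^ i * of_nat m) u + smult_mat (ell ^ (2 * i) * of_nat (m choose 2)) (u ** u))"
proof (induction m)
  case 0
  have "smult_mat 0 u = 0" for u :: "'a zp_mat" by (simp add: entries)
  then show ?case by (simp add: binomial_eq_0)
next
  case (Suc m)
  let ?L = "ell ^ i :: 'a zp" and ?c = "of_nat (m choose 2) :: 'a zp"
  let ?f = "\<lambda>m. mat 1 + smult_mat (ell ^ i * of_nat m) u
    + smult_mat (ell ^ (2 * i) * of_nat (m choose 2)) (u ** u)"
  have p: "ell ^ (2 * i) = ?L * ?L" "ell ^ (3 * i) = ?L * ?L * ?L"
    by (simp_all add: mult_2 numeral_3_eq_3 power_add mult.assoc)
  have c: "of_nat (Suc m choose 2) = ?c + of_nat m"
    by (simp add: numeral_2_eq_2)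
  have "lev i u ** ?f m = ?f (Suc m) + smult_mat (ell ^ (3 * i)) (smult_mat ?c (u ** (u ** u)))"
    unfolding lev_def p c of_nat_Suc by (simp add: entries algebra_simps)
  then have "mcong (3 * i) (lev i u ** ?f m) (?f (Suc m))"
    unfolding mcong_iff_ex by blast
  with mcong_mult[OF mcong_refl Suc.IH, of "lev i u"] show ?case
    by (auto intro: mcong_trans)
qed

lemma leading_mpow:
  assumes "k \<le> i" "mcong (i + k) A (lev i u)"
  shows "mcong (i + k) (mpow A m) (lev i (smult_mat (of_nat m) u))"
proof (induction m)
  case 0
  have "smult_mat 0 u = 0" by (simp add: entries)
  then show ?case by simp
next
  case (Suc m)
  have "smult_mat (of_nat (Suc m)) u = u + smult_mat (of_nat m) u"
    by (simp add: entries algebra_simps)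
  then show ?case using leading_mult[OF assms Suc.IH] by simp
qed

text \<open>Raising to the power \<open>\<ell>\<close> moves the leading term one level up. For odd \<open>\<ell>\<close> this holds already
  at level 1, because \<open>\<ell>\<close> divides the binomial coefficient in front of the square.\<close>

lemma leading_mpow_ell:
  assumes "CARD('l) > 2" "i \<ge> 1" "mcong (i + 1) A (lev i (u :: 'l :: prime_card zp_mat))"
  shows "mcong (i + 2) (mpow A CARD('l)) (lev (i + 1) u)"
proof -
  obtain U where U: "A = lev i U"
    using mcong_lev_imp_1[OF assms(3)] by (auto simp: mcong_1_iff_lev)
  have "mcong 1 U u"
    using assms(3) unfolding U lev_def mcong_def
    by (simp add: power_Suc2 flip: right_diff_distrib del: power_Suc)
  then have 1: "mcong (i + 2) (lev (i + 1) U) (lev (i + 1) u)"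
    using lev_cong[of 1 U u "i + 1"] by simp
  have "CARD('l) dvd (CARD('l) choose 2)"
    using prime_card[where ?'a = 'l] assms(1) by (intro dvd_choose_prime) auto
  then obtain c where c: "CARD('l) choose 2 = CARD('l) * c" by (elim dvdE)
  let ?f = "mat 1 + smult_mat (ell ^ i * of_nat CARD('l)) U
    + smult_mat (ell ^ (2 * i) * of_nat (CARD('l) choose 2)) (U ** U)"
  have "mcong (i + 2) (mpow A CARD('l)) ?f"
    unfolding U by (rule mcong_mono[OF _ mpow_lev]) (use assms(2) in simp)
  also have "mcong (i + 2) ?f (lev (i + 1) U)"
  proof (rule mcong_mono)
    show "i + 2 \<le> 2 * i + 1" using assms(2) by simp
    have "?f = lev (i + 1) U + smult_mat (ell ^ (2 * i + 1)) (smult_mat (of_nat c) (U ** U))"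
      unfolding c by (simp add: lev_def entries mult_ac)
    then show "mcong (2 * i + 1) ?f (lev (i + 1) U)"
      unfolding mcong_iff_ex by blast
  qed
  also note 1
  finally show ?thesis .
qed

lemma leading_mpow_ell_power:
  assumes "CARD('l) > 2" "i \<ge> 1" "mcong (i + 1) A (lev i (u :: 'l :: prime_card zp_mat))"
  shows "mcong (i + s + 1) (mpow A (CARD('l) ^ s)) (lev (i + s) u)"
proof (induction s)
  case 0
  show ?case using assms(3) by (simp add: matrix_mul_rid)
next
  case (Suc s)
  have "mcong (i + s + 2) (mpow (mpow A (CARD('l) ^ s)) CARD('l)) (lev (i + s + 1) u)"
    by (rule leading_mpow_ell) (use assms Suc in auto)
  then show ?case by (simp add: mult.commute flip: mpow_mult)
qed

text \<open>Every trace-zero matrix is the leading term of a matrix of determinant 1: correcting a single entry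
  of \<open>lev i u\<close> to second order suffices.\<close>

lemma sl2_lift:
  fixes u :: "'l :: prime_card zp_mat"
  assumes "trace u = 0" "i \<ge> 1"
  obtains x where "x \<in> BB i" "mcong (2 * i) x (lev i u)"
proof -
  let ?L = "ell ^ i :: 'l zp"
  define a b c where abc: "a = u $ 1 $ 1" "b = u $ 1 $ 2" "c = u $ 2 $ 1"
  have d: "u $ 2 $ 2 = - a" using assms(1) by (simp add: abc trace_2 add_eq_0_iff)
  have "(ell :: 'l zp) dvd ?L * a" using assms(2) by (intro dvd_mult2) (simp add: dvd_power)
  then have "\<not> ell dvd 1 + ?L * a" using not_ell_dvd_1 by (metis dvd_add_left_iff)
  then obtain v where v: "(1 + ?L * a) * v = 1" using is_unit_zp_iff by (metis dvdE)
  define x where "x = mat2 (1 + ?L * a) (?L * b) (?L * c) ((1 + ?L * ?L * b * c) * v)"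
  have "det x = (1 + ?L * ?L * b * c) * ((1 + ?L * a) * v) - ?L * b * (?L * c)"
    by (simp add: x_def det_2 algebra_simps)
  then have "det x = 1" unfolding v by (simp add: algebra_simps)
  moreover have q: "mcong (2 * i) x (lev i u)"
  proof -
    have "(1 + ?L * ?L * b * c) * v - (1 + ?L * (- a))
        = ((1 + ?L * a) * v - 1) * (1 - ?L * a) + ?L * ?L * (a * a * v + b * c * v)"
      by (simp add: algebra_simps)
    then have "(1 + ?L * ?L * b * c) * v - (1 + ?L * (- a)) = ?L * ?L * (a * a * v + b * c * v)"
      by (simp add: v)
    then show ?thesis
      by (simp add: mcong_def forall_2 x_def lev_def abc[symmetric] d mult_2 power_add)
  qed
  moreover have "mcong i x (mat 1)" using q by (rule mcong_lev_imp_1[of i i, folded mult_2])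
  ultimately show ?thesis using that by (auto simp: BB_iff)
qed

section \<open>Powers of matrices modulo \<open>\<ell>\<close>\<close>

lemma prime_power_sum:
  fixes a b :: "'a :: comm_ring_1"
  assumes "prime p"
  obtains q where "(a + b) ^ p = a ^ p + b ^ p + of_nat p * q"
proof -
  have p: "p > 0" using assms by (simp add: prime_gt_0_nat)
  let ?t = "\<lambda>k. of_nat (p choose k) * a ^ k * b ^ (p - k)"
  have "{..p} = insert 0 (insert p {0<..<p})" using p by auto
  then have "(a + b) ^ p = b ^ p + (a ^ p + (\<Sum>k\<in>{0<..<p}. ?t k))"
    using p by (simp add: binomial_ring)
  moreover have "of_nat p dvd (\<Sum>k\<in>{0<..<p}. ?t k)"
  proof (rule dvd_sum)
    fix k assume "k \<in> {0<..<p}"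
    then have "p dvd (p choose k)" using assms by (intro dvd_choose_prime) auto
    then obtain c where "p choose k = p * c" by (elim dvdE)
    then show "of_nat p dvd ?t k" by (simp add: mult.assoc)
  qed
  ultimately show ?thesis using that by (auto simp: dvd_def add_ac)
qed

lemma zp_fermat:
  fixes x :: "'l :: prime_card zp"
  shows "ell dvd x ^ CARD('l) - x"
proof -
  have nat: "ell dvd (of_nat k :: 'l zp) ^ CARD('l) - of_nat k" for k
  proof (induction k)
    case 0
    then show ?case by (simp add: power_0_left)
  next
    case (Suc k)
    obtain q where "(of_nat k + 1 :: 'l zp) ^ CARD('l) = of_nat k ^ CARD('l) + 1 ^ CARD('l) + ell * q"
      using prime_power_sum[OF prime_card] by blast
    then have "(of_nat (Suc k) :: 'l zp) ^ CARD('l) - of_nat (Suc k)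
        = (of_nat k ^ CARD('l) - of_nat k) + ell * q"
      by (simp add: algebra_simps)
    then show ?case using Suc by (simp only: dvd_add dvd_triv_left)
  qed
  obtain k where k: "ell ^ 1 dvd x - of_nat k" by (rule zp_approx_nat)
  have "x - of_nat k dvd x ^ CARD('l) - of_nat k ^ CARD('l)"
    by (metis power_diff_sumr2 dvd_triv_left)
  then have "ell dvd x ^ CARD('l) - of_nat k ^ CARD('l)"
    using k dvd_trans by auto
  then have "ell dvd (x ^ CARD('l) - of_nat k ^ CARD('l)) + (of_nat k ^ CARD('l) - of_nat k)
      - (x - of_nat k)"
    using nat[of k] k by (simp only: dvd_add dvd_diff power_one_right)
  then show ?thesis by simp
qed

text \<open>Evaluation of polynomials at a matrix, which transports the binomial theorem to commuting
  matrices.\<close>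

definition mat_eval :: "'l :: prime_card zp_mat \<Rightarrow> 'l zp poly \<Rightarrow> 'l zp_mat" where
  "mat_eval A p = fold_coeffs (\<lambda>a M. smult_mat a (mat 1) + A ** M) p 0"

lemma mat_eval_0 [simp]: "mat_eval A 0 = 0"
  by (simp add: mat_eval_def)

lemma mat_eval_pCons [simp]: "mat_eval A (pCons a p) = smult_mat a (mat 1) + A ** mat_eval A p"
proof (cases "a = 0 \<and> p = 0")
  case True
  have "smult_mat 0 (mat 1) + A ** 0 = 0" by (simp add: entries)
  with True show ?thesis by simp
next
  case False
  then show ?thesis by (cases "p = 0") (auto simp: mat_eval_def)
qed

lemma mat_eval_add: "mat_eval A (p + q) = mat_eval A p + mat_eval A q"
  by (induction p q rule: poly_induct2) (simp_all add: entries algebra_simps)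

lemma mat_eval_smult: "mat_eval A (Polynomial.smult c p) = smult_mat c (mat_eval A p)"
  by (induction p) (simp_all add: entries algebra_simps)

lemma mat_eval_mult: "mat_eval A (p * q) = mat_eval A p ** mat_eval A q"
proof (induction p)
  case (pCons a p)
  have "mat_eval A (pCons a p * q) = smult_mat a (mat_eval A q) + A ** (mat_eval A p ** mat_eval A q)"
    using pCons.IH by (simp add: mat_eval_add mat_eval_smult entries)
  then show ?case by (simp add: entries algebra_simps)
qed (simp add: entries)

lemma mat_eval_power: "mat_eval A (p ^ m) = mpow (mat_eval A p) m"
proof (induction m)
  case 0
  show ?case by (simp add: one_pCons entries)
qed (simp add: mat_eval_mult)

lemma mpow_traceless:
  assumes "trace Z = 0"
  shows "mpow Z (2 * h + 1) = smult_mat ((- det Z) ^ h) Z"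
proof (induction h)
  case (Suc h)
  have "Z $ 2 $ 2 = - Z $ 1 $ 1" using assms by (simp add: trace_2 add_eq_0_iff)
  then have "Z ** (Z ** Z) = smult_mat (- det Z) Z"
    by (simp add: entries algebra_simps)
  then have "Z ** (Z ** mpow Z (2 * h + 1)) = smult_mat ((- det Z) ^ Suc h) Z"
    unfolding Suc.IH by (simp add: mult.commute)
  then show ?case by simp
qed (simp add: matrix_mul_rid)

lemma frobenius_shift:
  fixes Z :: "'l :: prime_card zp_mat"
  assumes "trace Z = 0" "CARD('l) = 2 * h + 1"
  shows "mcong 1 (mpow (smult_mat c (mat 1) + Z) CARD('l))
    (smult_mat c (mat 1) + smult_mat ((- det Z) ^ h) Z)"
proof -
  obtain q where q: "([:c:] + [:0, 1:]) ^ CARD('l)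
      = [:c:] ^ CARD('l) + [:0, 1:] ^ CARD('l) + of_nat CARD('l) * q"
    using prime_power_sum[OF prime_card, where ?'a1 = 'l] by blast
  have ev: "mat_eval Z [:0, 1:] = Z"
    by (simp add: entries)
  have cc: "[:c:] ^ m = [:c ^ m:]" for m
    by (induction m) (simp_all add: one_pCons)
  have cst: "mat_eval Z [:a:] = smult_mat a (mat 1)" for a
    by (simp add: entries)
  have "of_nat CARD('l) * q = Polynomial.smult ell q" by (simp add: of_nat_poly)
  then have "mpow (smult_mat c (mat 1) + Z) CARD('l)
      = smult_mat (c ^ CARD('l)) (mat 1) + mpow Z CARD('l) + smult_mat (ell ^ 1) (mat_eval Z q)"
    using arg_cong[OF q, of "mat_eval Z"]
    unfolding mat_eval_power mat_eval_add ev cc cst by (simp only: mat_eval_smult power_one_right)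
  then have "mcong 1 (mpow (smult_mat c (mat 1) + Z) CARD('l))
      (smult_mat (c ^ CARD('l)) (mat 1) + mpow Z CARD('l))"
    unfolding mcong_iff_ex by blast
  also have "mcong 1 \<dots> (smult_mat c (mat 1) + smult_mat ((- det Z) ^ h) Z)"
    unfolding mpow_traceless[OF assms(1), of h, folded assms(2)]
    by (intro mcong_add mcong_scalar) (auto simp: zp_fermat)
  finally show ?thesis .
qed

text \<open>Write \<open>y = c + y\<^sub>0\<close> with \<open>y\<^sub>0\<close> of trace zero, so that \<open>y\<^sub>0\<^sup>2\<close> is a scalar \<open>\<delta>\<close>.
  Modulo \<open>\<ell>\<close>, every raising to the power \<open>\<ell>\<close> multiplies the trace-zero part by the power
  \<open>\<eta>\<close> of \<open>\<delta>\<close> with exponent \<open>(\<ell> - 1) / 2\<close>, and \<open>\<eta>\<^sup>3 = \<eta>\<close> by Fermat. Hence the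
  third iterate agrees with the first.\<close>

lemma SL2_exponent:
  fixes y :: "'l :: prime_card zp_mat"
  assumes "CARD('l) > 2" "det y = 1"
  shows "mcong 1 (mpow y (CARD('l) * (CARD('l) ^ 2 - 1))) (mat 1)"
proof -
  let ?l = "CARD('l)"
  have "odd ?l" using assms(1) prime_card[where ?'a = 'l] prime_odd_nat by blast
  then obtain h where h: "?l = 2 * h + 1" by (elim oddE)
  have h1: "h \<ge> 1" using h assms(1) by simp
  have cong_half: "ell dvd a ^ ?l * b - a * b" for a b :: "'l zp"
    using zp_fermat[of a] by (simp flip: left_diff_distrib)
  define c where "c = half_zp * trace y"
  define Z where "Z = Theta y"
  define \<eta> where "\<eta> = (- det Z) ^ h"
  have half: "(half_zp :: 'l zp) + half_zp = 1"
    using two_half_zp[OF assms(1)] by (simp only: mult_2)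
  have tZ: "trace Z = 0"
  proof -
    have "trace Z = trace y - (half_zp + half_zp) * trace y"
      by (simp add: Z_def Theta_def entries algebra_simps)
    then show ?thesis by (simp add: half)
  qed
  have y: "y = smult_mat c (mat 1) + Z"
    by (simp add: Z_def Theta_def c_def)
  have step: "mcong 1 (mpow (smult_mat c (mat 1) + smult_mat a Z) ?l)
      (smult_mat c (mat 1) + smult_mat (a * \<eta>) Z)" for a
  proof -
    have ta: "trace (smult_mat a Z) = 0"
      using tZ by (simp add: trace_2 flip: distrib_left)
    have "- det (smult_mat a Z) = a ^ 2 * - det Z"
      by (simp add: det_2 power2_eq_square algebra_simps)
    moreover have al: "a ^ ?l = a ^ h * a ^ h * a"
      unfolding h by (simp only: power_add mult_2 power_one_right)
    ultimately have "(- det (smult_mat a Z)) ^ h * a = a ^ ?l * \<eta>"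
      unfolding al by (simp add: \<eta>_def power2_eq_square power_mult_distrib mult_ac
          del: mult_minus_left mult_minus_right)
    then have "mcong 1 (mpow (smult_mat c (mat 1) + smult_mat a Z) ?l)
      (smult_mat c (mat 1) + smult_mat (a ^ ?l * \<eta>) Z)"
      using frobenius_shift[OF ta h, of c] by simp
    also have "mcong 1 \<dots> (smult_mat c (mat 1) + smult_mat (a * \<eta>) Z)"
      using cong_half[of a \<eta>] by (intro mcong_add mcong_scalar) auto
    finally show ?thesis .
  qed
  have "ell dvd \<eta> ^ 3 - \<eta>"
  proof -
    have "3 * h = ?l + (h - 1)" using h h1 by simp
    then have "\<eta> ^ 3 = (- det Z) ^ ?l * (- det Z) ^ (h - 1)"
      by (simp add: \<eta>_def flip: power_mult power_add) (simp add: mult.commute)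
    moreover have "\<eta> = - det Z * (- det Z) ^ (h - 1)"
      using h1 by (simp add: \<eta>_def flip: power_Suc)
    ultimately show ?thesis using cong_half by metis
  qed
  then have eta: "mcong 1 (smult_mat c (mat 1) + smult_mat (\<eta> ^ 3) Z) (smult_mat c (mat 1) + smult_mat \<eta> Z)"
    by (intro mcong_add mcong_scalar) auto
  have 1: "mcong 1 (mpow y ?l) (smult_mat c (mat 1) + smult_mat \<eta> Z)"
    using step[of 1] y by simp
  have 2: "mcong 1 (mpow (mpow y ?l) ?l) (smult_mat c (mat 1) + smult_mat (\<eta> ^ 2) Z)"
    using mcong_trans[OF mcong_mpow[OF 1] step[of \<eta>]] by (simp add: power2_eq_square)
  have 3: "mcong 1 (mpow (mpow (mpow y ?l) ?l) ?l) (smult_mat c (mat 1) + smult_mat (\<eta> ^ 3) Z)"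
    using mcong_trans[OF mcong_mpow[OF 2] step[of "\<eta> ^ 2"]] by (simp add: power3_eq_cube power2_eq_square)
  have "?l * ?l * ?l = ?l + ?l * (?l ^ 2 - 1)"
    by (simp add: power2_eq_square algebra_simps)
  then have "mpow (mpow (mpow y ?l) ?l) ?l = mpow y ?l ** mpow y (?l * (?l ^ 2 - 1))"
    by (simp flip: mpow_mult mpow_add)
  then have "mcong 1 (mpow y ?l ** mpow y (?l * (?l ^ 2 - 1))) (smult_mat c (mat 1) + smult_mat (\<eta> ^ 3) Z)"
    using 3 by simp
  also note eta
  also note mcong_sym[OF 1]
  finally have "mcong 1 (mpow y ?l ** mpow y (?l * (?l ^ 2 - 1))) (mpow y ?l ** mat 1)"
    by (simp only: matrix_mul_rid)
  moreover have "adj2 (mpow y ?l) ** mpow y ?l = mat 1"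
    by (rule adj2_mult_det_1) (simp add: det_mpow assms(2))
  ultimately show ?thesis by (rule mcong_cancel_left[rotated])
qed

section \<open>Open groups of pairs with equal determinant\<close>

lemma BB_leading_term:
  fixes x :: "'l :: prime_card zp_mat"
  assumes "x \<in> BB m" "m \<ge> 1"
  obtains u where "trace u = 0" "mcong (m + m) x (lev m u)"
proof -
  obtain U where U: "x = lev m U" using assms(1) by (auto simp: BB_iff mcong_1_iff_lev)
  have "det (lev m U) = 1 + ell ^ m * (trace U + ell ^ m * det U)"
    by (simp add: lev_def entries algebra_simps)
  then have tr: "trace U = - (ell ^ m * det U)"
    using assms(1) by (simp add: BB_iff U add_eq_0_iff2)
  define u where "u = mat2 (U $ 1 $ 1) (U $ 1 $ 2) (U $ 2 $ 1) (- (U $ 1 $ 1))"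
  have "U $ 2 $ 2 = - (ell ^ m * det U) - U $ 1 $ 1"
    using tr unfolding trace_2 by (metis add_diff_cancel_left')
  then have "mcong m U u" by (simp add: mcong_def forall_2 u_def)
  then have "mcong (m + m) x (lev m u)" unfolding U by (rule lev_cong)
  moreover have "trace u = 0" by (simp add: u_def trace_2)
  ultimately show ?thesis using that by blast
qed

text \<open>Successive approximation. Closedness of the group enters only through its containing some
  congruence subgroup, so that finitely many steps suffice.\<close>

lemma BB_subset_by_leading_terms:
  fixes S :: "'l :: prime_card zp_mat set"
  assumes mult: "\<And>x y. x \<in> S \<Longrightarrow> y \<in> S \<Longrightarrow> x ** y \<in> S"
    and N: "BB N \<subseteq> S" and m0: "m0 \<ge> 1"
    and leading: "\<And>m u. m \<ge> m0 \<Longrightarrow> trace u = 0 \<Longrightarrow> \<exists>x\<in>S. det x = 1 \<and> mcong (m + 1) x (lev m u)"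
  shows "BB m0 \<subseteq> S"
proof -
  define M where "M = max N m0"
  have M: "N \<le> M" "m0 \<le> M" by (simp_all add: M_def)
  from M(2) show ?thesis
  proof (induction rule: inc_induct)
    case base
    show ?case using N BB_antimono[OF M(1)] by auto
  next
    case (step m)
    show ?case
    proof
      fix x assume x: "x \<in> (BB m :: 'l zp_mat set)"
      have m: "m0 \<le> m" using step.hyps by simp
      obtain u where u: "trace u = 0" "mcong (m + m) x (lev m u)"
        using BB_leading_term[OF x] m m0 by auto
      have xu: "mcong (m + 1) x (lev m u)"
        by (rule mcong_mono[OF _ u(2)]) (use m m0 in simp)
      obtain x' where x': "x' \<in> S" "det x' = 1" "mcong (m + 1) x' (lev m u)"
        using leading[OF m u(1)] by blast
      have "mcong (m + 1) x x'" using xu mcong_sym[OF x'(3)] by (rule mcong_trans)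
      then have "mcong (m + 1) (adj2 x' ** x) (adj2 x' ** x')" by (intro mcong_mult mcong_refl)
      then have "mcong (Suc m) (adj2 x' ** x) (mat 1)"
        using x'(2) by (simp add: adj2_mult_det_1)
      moreover have "det (adj2 x' ** x) = 1" using x x'(2) by (simp add: det_mul BB_iff)
      ultimately have "adj2 x' ** x \<in> S" using step.IH by (auto simp: BB_iff)
      then have "x' ** (adj2 x' ** x) \<in> S" using x'(1) mult by blast
      then show "x \<in> S" using x'(2) by (simp add: matrix_mul_assoc adj2_mult_det_1)
    qed
  qed
qed

definition pair_monoid :: "('l :: prime_card zp_mat \<times> 'l zp_mat) set \<Rightarrow> bool" where
  "pair_monoid S \<longleftrightarrow> (mat 1, mat 1) \<in> S \<and>
    (\<forall>a b c d. (a, b) \<in> S \<longrightarrow> (c, d) \<in> S \<longrightarrow> (a ** c, b ** d) \<in> S)"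

text \<open>The pairs of leading terms, at levels \<open>i\<close> and \<open>j\<close> and to relative precision \<open>k\<close>, of the
  elements of \<open>S\<close>. For \<open>k \<le> i, j\<close> they form a module over \<open>\<int>\<^sub>\<ell>\<close>: a linear substitute for the
  Lie algebra of \<open>S\<close>.\<close>

definition leads ::
    "('l :: prime_card zp_mat \<times> 'l zp_mat) set \<Rightarrow> nat \<Rightarrow> nat \<Rightarrow> nat \<Rightarrow> ('l zp_mat \<times> 'l zp_mat) set" where
  "leads S i j k = {(u, v). \<exists>x y. (x, y) \<in> S \<and> mcong (i + k) x (lev i u) \<and> mcong (j + k) y (lev j v)}"

lemma pair_monoid_mpow: "pair_monoid S \<Longrightarrow> (a, b) \<in> S \<Longrightarrow> (mpow a m, mpow b m) \<in> S"
  by (induction m) (auto simp: pair_monoid_def)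

lemma leads_add:
  assumes "pair_monoid S" "k \<le> i" "k \<le> j" "(u, v) \<in> leads S i j k" "(u', v') \<in> leads S i j k"
  shows "(u + u', v + v') \<in> leads S i j k"
proof -
  obtain x y where 1: "(x, y) \<in> S" "mcong (i + k) x (lev i u)" "mcong (j + k) y (lev j v)"
    using assms(4) by (auto simp: leads_def)
  obtain x' y' where 2: "(x', y') \<in> S" "mcong (i + k) x' (lev i u')" "mcong (j + k) y' (lev j v')"
    using assms(5) by (auto simp: leads_def)
  have "(x ** x', y ** y') \<in> S" using assms(1) 1 2 by (simp add: pair_monoid_def)
  moreover note leading_mult[OF assms(2) 1(2) 2(2)] leading_mult[OF assms(3) 1(3) 2(3)]
  ultimately show ?thesis unfolding leads_def by blast
qed

lemma leads_smult:
  fixes c :: "'l :: prime_card zp"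
  assumes "pair_monoid S" "k \<le> i" "k \<le> j" "(u, v) \<in> leads S i j k"
  shows "(smult_mat c u, smult_mat c v) \<in> leads S i j k"
proof -
  obtain x y where 1: "(x, y) \<in> S" "mcong (i + k) x (lev i u)" "mcong (j + k) y (lev j v)"
    using assms(4) by (auto simp: leads_def)
  obtain m where "ell ^ k dvd c - of_nat m" by (rule zp_approx_nat)
  then have "ell ^ k dvd of_nat m - c" by (metis dvd_minus_iff minus_diff_eq)
  then have m: "mcong k (smult_mat (of_nat m) w) (smult_mat c w)" for w :: "'l zp_mat"
    by (rule mcong_scalar)
  have "mcong (i + k) (mpow x m) (lev i (smult_mat c u))"
    using leading_mpow[OF assms(2) 1(2)] lev_cong[OF m] by (rule mcong_trans)
  moreover have "mcong (j + k) (mpow y m) (lev j (smult_mat c v))"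
    using leading_mpow[OF assms(3) 1(3)] lev_cong[OF m] by (rule mcong_trans)
  moreover have "(mpow x m, mpow y m) \<in> S" using assms(1) 1(1) by (rule pair_monoid_mpow)
  ultimately show ?thesis unfolding leads_def by blast
qed

text \<open>The level \<open>N\<close> stands for the openness of \<open>G\<close>. It makes successive approximations end after
  finitely many steps; all bounds are in terms of \<open>n\<close>.\<close>

locale pair_group =
  fixes G :: "('l :: prime_card zp_mat \<times> 'l zp_mat) set" and n N :: nat
  assumes odd: "CARD('l) > 2"
    and one: "(mat 1, mat 1) \<in> G"
    and mult: "\<And>a b c d. (a, b) \<in> G \<Longrightarrow> (c, d) \<in> G \<Longrightarrow> (a ** c, b ** d) \<in> G"
    and inverse: "\<And>a b. (a, b) \<in> G \<Longrightarrow> \<exists>c d. (c, d) \<in> G \<and>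
      a ** c = mat 1 \<and> c ** a = mat 1 \<and> b ** d = mat 1 \<and> d ** b = mat 1"
    and det_eq: "\<And>a b. (a, b) \<in> G \<Longrightarrow> det a = det b"
    and n_pos: "n > 0"
    and proj1: "\<And>x. x \<in> BB n \<Longrightarrow> \<exists>y. (x, y) \<in> G"
    and proj2: "\<And>y. y \<in> BB n \<Longrightarrow> \<exists>x. (x, y) \<in> G"
    and level: "\<And>x y. x \<in> BB N \<Longrightarrow> y \<in> BB N \<Longrightarrow> (x, y) \<in> G"
begin

lemma pair_group_converse: "pair_group (G\<inverse>) n N"
proof
  fix a b assume "(a, b) \<in> G\<inverse>"
  then show "\<exists>c d. (c, d) \<in> G\<inverse> \<and> a ** c = mat 1 \<and> c ** a = mat 1 \<and> b ** d = mat 1 \<and> d ** b = mat 1"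
    using inverse[of b a] by auto
  show "det a = det b" using \<open>(a, b) \<in> G\<inverse>\<close> det_eq[of b a] by simp
qed (use odd one mult n_pos proj1 proj2 level in auto)

lemma monoid: "pair_monoid G"
  using one mult by (simp add: pair_monoid_def)

lemma adj2_mem:
  assumes "(a, b) \<in> G" "det a = 1"
  shows "(adj2 a, adj2 b) \<in> G"
proof -
  obtain c d where cd: "(c, d) \<in> G" "a ** c = mat 1" "b ** d = mat 1" using inverse[OF assms(1)] by blast
  have "det b = 1" using assms det_eq by metis
  have "c = adj2 a ** a ** c" using assms(2) by (simp add: adj2_mult_det_1)
  also have "\<dots> = adj2 a" unfolding matrix_mul_assoc[symmetric] cd(2) by simp
  finally have "c = adj2 a" .
  have "d = adj2 b ** b ** d" using \<open>det b = 1\<close> by (simp add: adj2_mult_det_1)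
  also have "\<dots> = adj2 b" unfolding matrix_mul_assoc[symmetric] cd(3) by simp
  finally have "d = adj2 b" .
  with \<open>c = adj2 a\<close> cd(1) show ?thesis by simp
qed

text \<open>A power of a lift of \<open>x\<close> lies in \<open>B(s)\<close> as soon as the exponent is divisible by
  \<open>\<ell>\<^sup>s\<close> and by \<open>\<ell>\<^sup>2 - 1\<close>. Since \<open>\<ell>\<^sup>2 - 1\<close> is a unit, taking this power only costs the
  first coordinate \<open>s\<close> levels.\<close>

lemma lift1:
  assumes "s \<ge> 1" "x \<in> BB (s + n)"
  shows "\<exists>y\<in>BB s. (x, y) \<in> G"
proof -
  let ?l = "CARD('l)"
  let ?e = "?l ^ 2 - 1"
  have "BB (s + n) \<subseteq> {x. \<exists>y\<in>BB s. (x, y) \<in> G}"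
  proof (rule BB_subset_by_leading_terms)
    fix x y assume "x \<in> {x. \<exists>y\<in>BB s. (x, y) \<in> G}" "y \<in> {x. \<exists>y\<in>BB s. (x, y) \<in> G}"
    then obtain x' y' where *: "x' \<in> BB s" "y' \<in> BB s" "(x, x') \<in> G" "(y, y') \<in> G" by blast
    have "mcong s (x' ** y') (mat 1 ** mat 1)" using * by (intro mcong_mult) (auto simp: BB_iff)
    then have "x' ** y' \<in> BB s" using * by (simp add: BB_iff det_mul)
    then show "x ** y \<in> {x. \<exists>y\<in>BB s. (x, y) \<in> G}" using mult[OF *(3,4)] by blast
  next
    have "mat 1 \<in> (BB k :: 'l zp_mat set)" for k by (simp add: BB_iff det_2)
    then show "BB N \<subseteq> {x. \<exists>y\<in>BB s. (x, y) \<in> G}" using level by blast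
  next
    fix m and u :: "'l zp_mat" assume m: "s + n \<le> m" and u: "trace u = 0"
    define i where "i = m - s"
    have i: "n \<le> i" "i \<ge> 1" "m = i + s" using m n_pos by (auto simp: i_def)
    have "trace (smult_mat (- 1) u) = 0" using u by (simp add: trace_2 add_eq_0_iff2)
    then obtain x0 where x0: "x0 \<in> BB i" "mcong (2 * i) x0 (lev i (smult_mat (- 1) u))"
      using sl2_lift[OF _ i(2)] by blast
    obtain y0 where y0: "(x0, y0) \<in> G" using proj1 x0(1) BB_antimono[OF i(1)] by blast
    have dx: "det x0 = 1" "det y0 = 1" using x0(1) det_eq[OF y0] by (auto simp: BB_iff)
    define x y where "x = mpow x0 (?l ^ s * ?e)" and "y = mpow y0 (?l ^ s * ?e)"
    have "(x, y) \<in> G" unfolding x_def y_def by (rule pair_monoid_mpow[OF monoid y0])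
    moreover have "det x = 1" "det y = 1" by (simp_all add: x_def y_def det_mpow dx)
    moreover have "mcong (m + 1) x (lev m u)"
    proof -
      have "mcong (i + 1) x0 (lev i (smult_mat (- 1) u))"
        by (rule mcong_mono[OF _ x0(2)]) (use i in simp)
      then have "mcong (m + 1) (mpow x0 (?l ^ s)) (lev m (smult_mat (- 1) u))"
        using leading_mpow_ell_power[OF odd i(2)] i(3) by blast
      then have "mcong (m + 1) x (lev m (smult_mat (of_nat ?e) (smult_mat (- 1) u)))"
        unfolding x_def mpow_mult by (intro leading_mpow) (use i in auto)
      also have "mcong (m + 1) \<dots> (lev m (smult_mat 1 u))"
      proof (rule lev_cong)
        have "of_nat ?e * (- 1) - 1 = ell ^ 1 * (- ell :: 'l zp)"
          by (simp add: of_nat_diff power2_eq_square)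
        then show "mcong 1 (smult_mat (of_nat ?e) (smult_mat (- 1) u)) (smult_mat 1 u)"
          unfolding smult_mat_smult by (intro mcong_scalar) (metis dvd_triv_left)
      qed
      finally show ?thesis by simp
    qed
    moreover have "mcong s y (mat 1)"
    proof -
      have "mcong 1 (mpow y0 (?l * ?e)) (mat 1)" using SL2_exponent[OF odd dx(2)] .
      then obtain v where v: "mpow y0 (?l * ?e) = lev 1 v" by (auto simp: mcong_1_iff_lev)
      have "?l ^ s * ?e = (?l * ?e) * ?l ^ (s - 1)"
        using assms(1) by (cases s) simp_all
      then have "y = mpow (lev 1 v) (?l ^ (s - 1))" 
        unfolding y_def using mpow_mult[of y0 "?l * ?e" "?l ^ (s - 1)"] by (simp only: v)
      moreover have "mcong (1 + (s - 1) + 1) (mpow (lev 1 v) (?l ^ (s - 1))) (lev (1 + (s - 1)) v)"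
        by (rule leading_mpow_ell_power) (use odd in auto)
      ultimately show ?thesis using assms(1) mcong_lev_imp_1[of s 1] by simp
    qed
    ultimately show "\<exists>x\<in>{x. \<exists>y\<in>BB s. (x, y) \<in> G}. det x = 1 \<and> mcong (m + 1) x (lev m u)"
      by (intro bexI[of _ x]) (auto simp: BB_iff)
  qed (use n_pos in simp)
  with assms(2) show ?thesis by blast
qed

lemma lift2:
  assumes "s \<ge> 1" "y \<in> BB (s + n)"
  shows "\<exists>x\<in>BB s. (x, y) \<in> G"
proof -
  interpret conv: pair_group "G\<inverse>" n N by (rule pair_group_converse)
  show ?thesis using conv.lift1[OF assms] by simp
qed

end

section \<open>A discrepancy between traces forces a large congruence subgroup\<close>

lemma matrix_add_rdistrib: "(A + B) ** C = A ** C + B ** C"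
  by (simp add: matrix_matrix_mult_def vec_eq_iff sum.distrib algebra_simps)

text \<open>By the Cayley-Hamilton theorem \<open>Ad g + Ad g\<^sup>-\<^sup>1\<close> acts as a scalar on the
  trace-zero matrices orthogonal to \<open>g\<close> under the trace form, and the scalar depends only on the trace and the
  determinant.\<close>

lemma conj_add_conj_inverse:
  fixes g u :: "'l :: prime_card zp_mat"
  assumes "trace u = 0" "trace (g ** u) = 0" "g ** h = mat 1" "h ** g = mat 1" "det g * d = 1"
  shows "g ** u ** h + h ** u ** g = smult_mat (d * trace g ^ 2 - 2) u"
proof -
  have "h = smult_mat (det g * d) (h ** mat 1)" using assms(5) by simp
  also have "\<dots> = smult_mat d (h ** (g ** adj2 g))"
    unfolding adj2_mult by (simp add: mult.commute)
  also have "\<dots> = smult_mat d (adj2 g)" using assms(4) by (simp add: matrix_mul_assoc)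
  finally have h: "h = smult_mat d (adj2 g)" .
  have u22: "u $ 2 $ 2 = - u $ 1 $ 1" using assms(1) by (simp add: trace_2 add_eq_0_iff)
  have "g ** u ** adj2 g + adj2 g ** u ** g
      = smult_mat (trace g ^ 2 - 2 * det g) u
        + smult_mat (trace (g ** u)) (smult_mat (trace g) (mat 1) - smult_mat 2 g)"
    by (simp add: adj2_def entries u22 power2_eq_square algebra_simps)
  then have *: "g ** u ** adj2 g + adj2 g ** u ** g = smult_mat (trace g ^ 2 - 2 * det g) u"
    using assms(2) by (simp add: entries)
  have "g ** u ** h + h ** u ** g = smult_mat d (g ** u ** adj2 g + adj2 g ** u ** g)"
    unfolding h by (simp add: smult_mat_add)
  also have "\<dots> = smult_mat (d * trace g ^ 2 - 2 * (det g * d)) u"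
    unfolding * by (simp add: algebra_simps)
  finally show ?thesis using assms(5) by simp
qed

context pair_group
begin

definition SL_part :: "('l zp_mat \<times> 'l zp_mat) set" where
  "SL_part = {(x, y). (x, y) \<in> G \<and> det x = 1}"

lemma SL_part_monoid: "pair_monoid SL_part"
  using one mult by (auto simp: pair_monoid_def SL_part_def det_mul det_I)

lemma leads_SL_part_conj:
  assumes "(u, v) \<in> leads SL_part i j k" "(g1, g2) \<in> G" "(h1, h2) \<in> G"
    "g1 ** h1 = mat 1" "g2 ** h2 = mat 1"
  shows "(g1 ** u ** h1, g2 ** v ** h2) \<in> leads SL_part i j k"
proof -
  obtain x y where 1: "(x, y) \<in> G" "det x = 1" "mcong (i + k) x (lev i u)" "mcong (j + k) y (lev j v)"
    using assms(1) by (auto simp: leads_def SL_part_def)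
  have "det g1 * det h1 = 1" using arg_cong[OF assms(4), of det] by (simp add: det_mul det_I)
  then have "det (g1 ** x ** h1) = 1" using 1(2) by (simp add: det_mul)
  moreover have "(g1 ** x ** h1, g2 ** y ** h2) \<in> G" using 1(1) assms(2,3) mult by blast
  moreover note leading_conj[OF 1(3) assms(4)] leading_conj[OF 1(4) assms(5)]
  ultimately show ?thesis unfolding leads_def SL_part_def by blast
qed

lemma leads_SL_part_lift:
  assumes "s \<ge> 1" "trace v = 0"
  obtains u where "trace u = 0" "(u, v) \<in> leads SL_part s (s + n) s"
proof -
  obtain y where y: "y \<in> BB (s + n)" "mcong (2 * (s + n)) y (lev (s + n) v)"
    using sl2_lift[OF assms(2), of "s + n"] assms(1) by auto
  obtain x where x: "x \<in> BB s" "(x, y) \<in> G" using lift2[OF assms(1) y(1)] by blast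
  obtain u where u: "trace u = 0" "mcong (s + s) x (lev s u)"
    using BB_leading_term[OF x(1) assms(1)] by blast
  have "mcong (s + n + s) y (lev (s + n) v)" by (rule mcong_mono[OF _ y(2)]) simp
  moreover have "det x = 1" using x(1) by (simp add: BB_iff)
  ultimately have "(u, v) \<in> leads SL_part s (s + n) s" using x(2) u(2) by (auto simp: leads_def SL_part_def)
  with u(1) that show ?thesis by blast
qed

text \<open>Choose a pair \<open>(u, v)\<close> of leading terms with \<open>u\<close> orthogonal to \<open>g1\<close> and \<open>v\<close> to
  \<open>g2\<close>. On it \<open>Ad g + Ad g\<^sup>-\<^sup>1\<close> acts by scalars whose difference is, up to a unit, the
  discrepancy of the squared traces, so that a linear combination kills \<open>u\<close> and keeps \<open>v\<close>. This yields an
  element of \<open>G\<close> whose first coordinate is very close to 1, and dividing by a lift of that coordinate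
  makes it equal to 1 without disturbing the leading term of the second one.\<close>

lemma kernel_element:
  assumes g: "(g1, g2) \<in> G"
    and r: "ell ^ r dvd trace g1 ^ 2 - trace g2 ^ 2" "\<not> ell ^ Suc r dvd trace g1 ^ 2 - trace g2 ^ 2"
  obtains y v where "(mat 1, y) \<in> G" "mcong (2 * r + 3 * n + 1 + 1) y (lev (2 * r + 3 * n + 1) v)"
    "trace v = 0" "\<not> ell dvd v $ 1 $ 1 \<or> \<not> ell dvd v $ 1 $ 2 \<or> \<not> ell dvd v $ 2 $ 1"
proof -
  \<comment> \<open>The correction at the end is trivial modulo \<open>\<ell>\<close> to the power \<open>2 s - n\<close>, while the leading term to be
    kept sits at level \<open>s + n + r\<close>; this is the least \<open>s\<close> for which the former exceeds the latter.\<close>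
  define s where "s = r + 2 * n + 1"
  have s: "s \<ge> 1" "s \<le> s + n" by (simp_all add: s_def)
  define L where "L = leads SL_part s (s + n) s"
  have L_add: "(u + u', v + v') \<in> L" if "(u, v) \<in> L" "(u', v') \<in> L" for u v u' v'
    using leads_add[OF SL_part_monoid order_refl s(2)] that by (simp add: L_def)
  have L_smult: "(smult_mat c u, smult_mat c v) \<in> L" if "(u, v) \<in> L" for u v c
    using leads_smult[OF SL_part_monoid order_refl s(2)] that by (simp add: L_def)
  obtain h1 h2 where h: "(h1, h2) \<in> G" "g1 ** h1 = mat 1" "h1 ** g1 = mat 1"
    "g2 ** h2 = mat 1" "h2 ** g2 = mat 1"
    using inverse[OF g] by blast
  define d where "d = det h1"
  have d: "det g1 * d = 1" "det g2 * d = 1"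
    using arg_cong[OF h(2), of det] det_eq[OF g] by (simp_all add: d_def det_mul det_I)

  define vE vF vH :: "'l zp_mat" where "vE = mat2 0 1 0 0" "vF = mat2 0 0 1 0" "vH = mat2 1 0 0 (- 1)"
  have tv: "trace vE = 0" "trace vF = 0" "trace vH = 0" by (simp_all add: vE_vF_vH_def trace_2)
  obtain uE uF uH where u: "trace uE = 0" "(uE, vE) \<in> L" "trace uF = 0" "(uF, vF) \<in> L"
    "trace uH = 0" "(uH, vH) \<in> L"
    unfolding L_def by (metis leads_SL_part_lift[OF s(1)] tv)
  \<comment> \<open>two linear conditions on the three coordinates of \<open>v\<close>, hence a solution that is primitive\<close>
  obtain c1 c2 c3 where
    c: "trace (g1 ** uE) * c1 + trace (g1 ** uF) * c2 + trace (g1 ** uH) * c3 = 0"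
       "trace (g2 ** vE) * c1 + trace (g2 ** vF) * c2 + trace (g2 ** vH) * c3 = 0"
       "\<not> ell dvd c1 \<or> \<not> ell dvd c2 \<or> \<not> ell dvd c3"
    by (rule primitive_solution_2)
  define u v where "u = smult_mat c1 uE + smult_mat c2 uF + smult_mat c3 uH"
    and "v = smult_mat c1 vE + smult_mat c2 vF + smult_mat c3 vH"
  have uv: "(u, v) \<in> L" unfolding u_def v_def using u by (intro L_add L_smult)
  have tr_lin: "trace (g ** (smult_mat c1 a + smult_mat c2 b + smult_mat c3 c))
      = trace (g ** a) * c1 + trace (g ** b) * c2 + trace (g ** c) * c3" for g a b c :: "'l zp_mat"
    by (simp add: entries algebra_simps)
  have gu: "trace (g1 ** u) = 0" "trace (g2 ** v) = 0" unfolding u_def v_def tr_lin using c by auto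
  have tu: "trace u = 0" "trace v = 0"
    using tr_lin[of "mat 1"] u(1,3,5) tv by (simp_all add: u_def v_def)
  have v_entries: "v $ 1 $ 1 = c3" "v $ 1 $ 2 = c1" "v $ 2 $ 1 = c2"
    by (simp_all add: v_def vE_vF_vH_def)

  define \<tau> where "\<tau> = d * (trace g2 ^ 2 - trace g1 ^ 2)"
  have "(g1 ** u ** h1 + h1 ** u ** g1, g2 ** v ** h2 + h2 ** v ** g2) \<in> L"
    using uv g h unfolding L_def by (intro L_add[unfolded L_def] leads_SL_part_conj)
  then have "(smult_mat (d * trace g1 ^ 2 - 2) u, smult_mat (d * trace g2 ^ 2 - 2) v) \<in> L"
    using conj_add_conj_inverse[OF tu(1) gu(1) h(2,3) d(1)] conj_add_conj_inverse[OF tu(2) gu(2) h(4,5) d(2)]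
    by simp
  then have "(smult_mat (d * trace g1 ^ 2 - 2) u + smult_mat (2 - d * trace g1 ^ 2) u,
      smult_mat (d * trace g2 ^ 2 - 2) v + smult_mat (2 - d * trace g1 ^ 2) v) \<in> L"
    using uv by (intro L_add L_smult)
  also have "smult_mat (d * trace g1 ^ 2 - 2) u + smult_mat (2 - d * trace g1 ^ 2) u = 0"
    by (simp add: entries algebra_simps)
  also have "smult_mat (d * trace g2 ^ 2 - 2) v + smult_mat (2 - d * trace g1 ^ 2) v = smult_mat \<tau> v"
    by (simp add: entries \<tau>_def algebra_simps)
  finally obtain X Y where XY: "(X, Y) \<in> G" "det X = 1" "mcong (s + s) X (mat 1)"
    "mcong (s + n + s) Y (lev (s + n) (smult_mat \<tau> v))"
    by (auto simp: L_def leads_def SL_part_def)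

  obtain t where "trace g1 ^ 2 - trace g2 ^ 2 = ell ^ r * t" using r(1) by (elim dvdE)
  moreover have "\<not> ell dvd t"
  proof
    assume "ell dvd t"
    then have "ell ^ r * ell dvd trace g1 ^ 2 - trace g2 ^ 2"
      unfolding \<open>trace g1 ^ 2 - trace g2 ^ 2 = ell ^ r * t\<close> by simp
    with r(2) show False by (simp add: mult.commute)
  qed
  moreover have "\<not> ell dvd d" using d(1) not_ell_dvd_1 by (metis dvd_mult)
  ultimately obtain w where w: "\<tau> = ell ^ r * w" "\<not> ell dvd w"
    using ell_dvd_mult_iff[of d t] by (metis (no_types, lifting) \<tau>_def dvd_minus_iff minus_diff_eq mult.left_commute mult_minus_right)

  define q where "q = 2 * r + 3 * n + 1"
  define s' where "s' = 2 * s - n"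
  have s': "s' \<ge> 1" "s + s = s' + n" "s' = q + 1" "s + n + r = q"
    by (simp_all add: s'_def s_def q_def)
  have "X \<in> BB (s' + n)" using XY(2,3) s'(2) by (simp add: BB_iff)
  then obtain y' where y': "y' \<in> BB s'" "(X, y') \<in> G" using lift1[OF s'(1)] by blast
  have "(adj2 X ** X, adj2 y' ** Y) \<in> G" using mult[OF adj2_mem[OF y'(2) XY(2)] XY(1)] .
  then have "(mat 1, adj2 y' ** Y) \<in> G" using XY(2) by (simp add: adj2_mult_det_1)
  moreover have "mcong (q + 1) (adj2 y' ** Y) (lev q (smult_mat w v))"
  proof -
    have "mcong s' (adj2 y') (mat 1)"
      using mcong_adj2[of s' y' "mat 1"] y'(1) by (simp add: BB_iff)
    moreover have "mcong s' Y (lev (s + n) (smult_mat \<tau> v))"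
      by (rule mcong_mono[OF _ XY(4)]) (simp add: s'_def)
    ultimately have "mcong s' (adj2 y' ** Y) (mat 1 ** lev (s + n) (smult_mat \<tau> v))"
      by (rule mcong_mult)
    moreover have "lev (s + n) (smult_mat \<tau> v) = lev q (smult_mat w v)"
      unfolding lev_def w s'(4)[symmetric] by (simp add: power_add mult.assoc)
    ultimately show ?thesis using s'(3) by simp
  qed
  moreover have "trace (smult_mat w v) = 0" using tu(2) by (simp add: trace_2 flip: distrib_left)
  moreover have "\<not> ell dvd smult_mat w v $ 1 $ 1 \<or> \<not> ell dvd smult_mat w v $ 1 $ 2 \<or> \<not> ell dvd smult_mat w v $ 2 $ 1"
    using c(3) w(2) by (auto simp: v_entries ell_dvd_mult_iff)
  ultimately show ?thesis using that unfolding q_def by blast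
qed

text \<open>The kernel of the first projection is normalized by \<open>B(n)\<close>. Double commutators with
  \<open>B(n)\<close> raise the level by \<open>2n\<close> and turn a single leading term that is nonzero modulo
  \<open>\<ell>\<close> into all of \<open>sl\<^sub>2\<close>, which is a simple Lie algebra modulo \<open>\<ell>\<close>.\<close>

lemma kernel_contains_BB:
  assumes y: "(mat 1, y) \<in> G" "mcong (q + 1) y (lev q v)" "q \<ge> 1" "trace v = 0"
    and v: "\<not> ell dvd v $ 1 $ 1 \<or> \<not> ell dvd v $ 1 $ 2 \<or> \<not> ell dvd v $ 2 $ 1"
  shows "z \<in> BB (q + 2 * n) \<Longrightarrow> (mat 1, z) \<in> G"
proof -
  define K where "K = {(x, y). (x, y) \<in> G \<and> x = mat 1}"
  have K: "pair_monoid K" using one mult by (fastforce simp: pair_monoid_def K_def)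
  define D where "D m = {v. \<exists>y. (mat 1, y) \<in> G \<and> mcong (m + 1) y (lev m v)}" for m
  have D: "v \<in> D m \<longleftrightarrow> (0, v) \<in> leads K m m 1" for m v
    by (auto simp: D_def leads_def K_def)
  have D_add: "v + v' \<in> D m" if "v \<in> D m" "v' \<in> D m" "m \<ge> 1" for m v v'
    using leads_add[OF K that(3,3)] that(1,2) unfolding D by (metis add_0)
  have D_smult: "smult_mat c v \<in> D m" if "v \<in> D m" "m \<ge> 1" for m v c
  proof -
    have "smult_mat c 0 = (0 :: 'l zp_mat)" by (simp add: entries)
    then show ?thesis using leads_smult[OF K that(2,2)] that(1) unfolding D by metis
  qed

  define br :: "'l zp_mat \<Rightarrow> 'l zp_mat \<Rightarrow> 'l zp_mat" where "br v w = v ** w - w ** v" for v w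
  have bracket: "br v w \<in> D (m + n)" if vD: "v \<in> D m" and m: "m \<ge> 1" and w: "trace w = 0" for v w m
  proof -
    obtain y where y: "(mat 1, y) \<in> G" "mcong (m + 1) y (lev m v)" using vD by (auto simp: D_def)
    obtain z where z: "z \<in> BB n" "mcong (2 * n) z (lev n w)" using sl2_lift[OF w, of n] n_pos by auto
    obtain x where x: "(x, z) \<in> G" using proj2[OF z(1)] by blast
    have dets: "det y = 1" "det z = 1" "det x = 1"
      using det_eq[OF y(1)] det_eq[OF x] z(1) by (auto simp: BB_iff det_I)
    obtain V where V: "y = lev m V" using mcong_lev_imp_1[OF y(2)] by (auto simp: mcong_1_iff_lev)
    obtain W where W: "z = lev n W" using z(1) by (auto simp: BB_iff mcong_1_iff_lev)
    have lev_cancel: "mcong 1 A B" if "mcong (i + 1) (lev i A) (lev i B)" for i and A B :: "'l zp_mat"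
      using that unfolding lev_def mcong_def
      by (simp add: power_Suc2 flip: right_diff_distrib del: power_Suc)
    have VW: "mcong 1 V v" "mcong 1 W w"
      proof -
      show "mcong 1 V v" using y(2) unfolding V by (rule lev_cancel)
      have "mcong (n + 1) z (lev n w)" by (rule mcong_mono[OF _ z(2)]) (use n_pos in simp)
      then show "mcong 1 W w" unfolding W by (rule lev_cancel)
    qed
    define P where "P = adj2 y ** adj2 z"
    have "(mat 1 ** x ** (adj2 (mat 1) ** adj2 x), y ** z ** P) \<in> G"
      unfolding P_def using y(1) x dets by (intro mult adj2_mem) (auto simp: det_I)
    moreover have "mat 1 ** x ** (adj2 (mat 1) ** adj2 x) = mat 1"
      using dets by (simp add: adj2_mult_det_1)
    moreover have "mcong (m + n + 1) (y ** z ** P) (lev (m + n) (br v w))"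
    proof -
      have "z ** y ** P = z ** (y ** adj2 y) ** adj2 z"
        by (simp add: P_def matrix_mul_assoc)
      then have zyP: "z ** y ** P = mat 1" using dets by (simp add: adj2_mult_det_1)
      have "y ** z = z ** y + smult_mat (ell ^ (m + n)) (br V W)"
        by (simp add: V W lev_def br_def entries power_add algebra_simps)
      then have "y ** z ** P = z ** y ** P + smult_mat (ell ^ (m + n)) (br V W ** P)"
        by (simp only: matrix_add_rdistrib smult_mat_mult)
      then have yzP: "y ** z ** P = lev (m + n) (br V W ** P)" by (simp add: zyP lev_def)
      have "mcong 1 y (mat 1)" "mcong 1 z (mat 1)"
        using m n_pos mcong_mono[of 1 m y "mat 1"] mcong_mono[of 1 n z "mat 1"]
        by (auto simp: V W mcong_1_iff_lev)
      then have "mcong 1 P (mat 1 ** mat 1)"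
        unfolding P_def using mcong_adj2[of 1 y "mat 1"] mcong_adj2[of 1 z "mat 1"] by (intro mcong_mult) auto
      moreover have "mcong 1 (br V W) (br v w)"
        unfolding br_def by (intro mcong_diff mcong_mult VW)
      ultimately have "mcong 1 (br V W ** P) (br v w)"
        using mcong_mult[of 1 "br V W" "br v w" P "mat 1"] by simp
      then show ?thesis unfolding yzP by (rule lev_cong)
    qed
    ultimately show ?thesis by (auto simp: D_def)
  qed

  define m0 where "m0 = q + 2 * n"
  define E F H :: "'l zp_mat" where "E = mat2 0 1 0 0" "F = mat2 0 0 1 0" "H = mat2 1 0 0 (- 1)"
  have tEFH: "trace E = 0" "trace F = 0" "trace H = 0" by (simp_all add: E_F_H_def trace_2)
  have m0: "m0 \<ge> 1" using y(3) by (simp add: m0_def)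
  define a b c where abc: "a = v $ 1 $ 1" "b = v $ 1 $ 2" "c = v $ 2 $ 1"
  have v22: "v $ 2 $ 2 = - a" using y(4) by (simp add: abc trace_2 add_eq_0_iff)
  have bb: "br (br v w1) w2 \<in> D m0" if "trace w1 = 0" "trace w2 = 0" for w1 w2
  proof -
    have "v \<in> D q" using y by (auto simp: D_def)
    then have "br (br v w1) w2 \<in> D (q + n + n)" using that y(3) by (intro bracket) auto
    then show ?thesis by (simp add: m0_def mult_2 add.assoc)
  qed
  have scale: "w \<in> D m0" if kw: "smult_mat k w \<in> D m0" and k: "\<not> ell dvd k" for w k
  proof -
    obtain k' where "k * k' = 1" using k is_unit_zp_iff by (metis dvdE)
    then show ?thesis using D_smult[OF kw m0, of k'] by (simp add: mult.commute)
  qed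
  have l2: "\<not> (ell :: 'l zp) dvd 2" by (rule not_ell_dvd_2[OF odd])
  have l4: "\<not> (ell :: 'l zp) dvd 4"
    using l2 ell_dvd_mult_iff[of "2 :: 'l zp" 2] by simp
  have
    "br (br v E) H = smult_mat (- 4 * a) E" "br (br v F) H = smult_mat (- 4 * a) F"
    "br (br v E) E = smult_mat (- 2 * c) E" "br (br v F) F = smult_mat (- 2 * b) F"
    "br (br v H) E = smult_mat (- 2 * c) H" "br (br v H) F = smult_mat (- 2 * b) H"
    "br (br v H) H = smult_mat (4 * b) E + smult_mat (4 * c) F"
    "br (br v F) E = smult_mat (2 * a) H + smult_mat (2 * b) E"
    by (simp_all add: br_def E_F_H_def entries abc[symmetric] v22)
  then have gen:
    "smult_mat (- 4 * a) E \<in> D m0" "smult_mat (- 4 * a) F \<in> D m0"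
    "smult_mat (- 2 * c) E \<in> D m0" "smult_mat (- 2 * b) F \<in> D m0"
    "smult_mat (- 2 * c) H \<in> D m0" "smult_mat (- 2 * b) H \<in> D m0"
    and gen2: "smult_mat (4 * b) E + smult_mat (4 * c) F \<in> D m0"
      "smult_mat (2 * a) H + smult_mat (2 * b) E \<in> D m0"
    using bb tEFH by metis+
  have minus: "w \<in> D m0" if "w + smult_mat k w' \<in> D m0" "w' \<in> D m0" for w w' k
  proof -
    have "w = (w + smult_mat k w') + smult_mat (- k) w'" by (simp add: entries)
    then show ?thesis using D_add[OF that(1) D_smult[OF that(2) m0] m0] by metis
  qed
  note u24 = ell_dvd_mult_iff l2 l4
  consider "\<not> ell dvd a" | "\<not> ell dvd b" | "\<not> ell dvd c" using v by (auto simp: abc)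
  then have EFH: "E \<in> D m0 \<and> F \<in> D m0 \<and> H \<in> D m0"
  proof cases
    case 1
    then have "E \<in> D m0" "F \<in> D m0" using gen(1,2) by (auto intro: scale simp: u24)
    moreover have "H \<in> D m0"
      using minus[OF gen2(2) \<open>E \<in> D m0\<close>] 1 by (auto intro: scale simp: u24)
    ultimately show ?thesis by blast
  next
    case 2
    then have "F \<in> D m0" "H \<in> D m0" using gen(4,6) by (auto intro: scale simp: u24)
    moreover have "E \<in> D m0"
      using minus[OF gen2(1) \<open>F \<in> D m0\<close>] 2 by (auto intro: scale simp: u24)
    ultimately show ?thesis by blast
  next
    case 3
    then have "E \<in> D m0" "H \<in> D m0" using gen(3,5) by (auto intro: scale simp: u24)
    moreover have "F \<in> D m0"
      using minus[of "smult_mat (4 * c) F" "4 * b" E] gen2(1) \<open>E \<in> D m0\<close> 3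
      by (auto intro: scale simp: u24 add.commute)
    ultimately show ?thesis by blast
  qed
  have all: "u \<in> D m" if "m0 \<le> m" "trace u = 0" for m u
    using that(1)
  proof (induction rule: dec_induct)
    case base
    have "u $ 2 $ 2 = - u $ 1 $ 1" using that(2) by (simp add: trace_2 add_eq_0_iff)
    then have "u = smult_mat (u $ 1 $ 2) E + smult_mat (u $ 2 $ 1) F + smult_mat (u $ 1 $ 1) H"
      by (simp add: E_F_H_def entries)
    moreover have "smult_mat (u $ 1 $ 2) E + smult_mat (u $ 2 $ 1) F + smult_mat (u $ 1 $ 1) H \<in> D m0"
      using EFH m0 by (intro D_add D_smult) auto
    ultimately show ?case by metis
  next
    case (step m)
    then obtain y where y: "(mat 1, y) \<in> G" "mcong (m + 1) y (lev m u)" by (auto simp: D_def)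
    have "mcong (m + 2) (mpow y CARD('l)) (lev (m + 1) u)"
      by (rule leading_mpow_ell[OF odd _ y(2)]) (use m0 step.hyps in simp)
    moreover have "(mat 1, mpow y CARD('l)) \<in> G"
      using pair_monoid_mpow[OF monoid y(1), of "CARD('l)"] by simp
    ultimately show ?case by (auto simp: D_def)
  qed
  have "BB m0 \<subseteq> {y. (mat 1, y) \<in> G}"
  proof (rule BB_subset_by_leading_terms)
    fix x y assume "x \<in> {y. (mat 1, y) \<in> G}" "y \<in> {y. (mat 1, y) \<in> G}"
    then show "x ** y \<in> {y. (mat 1, y) \<in> G}" using mult[of "mat 1" x "mat 1" y] by simp
  next
    show "BB N \<subseteq> {y. (mat 1, y) \<in> G}" using level[of "mat 1"] by (auto simp: BB_iff det_I)
  next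
    fix m and u :: "'l zp_mat" assume "m0 \<le> m" "trace u = 0"
    then obtain y where "(mat 1, y) \<in> G" "mcong (m + 1) y (lev m u)" using all by (auto simp: D_def)
    then show "\<exists>x\<in>{y. (mat 1, y) \<in> G}. det x = 1 \<and> mcong (m + 1) x (lev m u)"
      using det_eq[of "mat 1" y] by (auto simp: det_I)
  qed (rule m0)
  then show "z \<in> BB (q + 2 * n) \<Longrightarrow> (mat 1, z) \<in> G" by (auto simp: m0_def)
qed

lemma kernel_contains_BB_of_discrepancy:
  assumes g: "(g1, g2) \<in> G"
    and r: "ell ^ r dvd trace g1 ^ 2 - trace g2 ^ 2" "\<not> ell ^ Suc r dvd trace g1 ^ 2 - trace g2 ^ 2"
    and z: "z \<in> BB (2 * r + 5 * n + 1)"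
  shows "(mat 1, z) \<in> G"
proof -
  obtain y v where y: "(mat 1, y) \<in> G" "mcong (2 * r + 3 * n + 1 + 1) y (lev (2 * r + 3 * n + 1) v)"
    "trace v = 0" "\<not> ell dvd v $ 1 $ 1 \<or> \<not> ell dvd v $ 1 $ 2 \<or> \<not> ell dvd v $ 2 $ 1"
    by (rule kernel_element[OF g r])
  have "2 * r + 5 * n + 1 = (2 * r + 3 * n + 1) + 2 * n" by simp
  with z have "z \<in> BB ((2 * r + 3 * n + 1) + 2 * n)" by metis
  then show ?thesis using kernel_contains_BB[OF y(1,2) _ y(3,4)] by simp
qed

lemma contains_BB2_of_discrepancy:
  assumes g: "(g1, g2) \<in> G"
    and r: "ell ^ r dvd trace g1 ^ 2 - trace g2 ^ 2" "\<not> ell ^ Suc r dvd trace g1 ^ 2 - trace g2 ^ 2"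
  shows "BB2 (2 * r + 5 * n + 1) (2 * r + 5 * n + 1) \<subseteq> G"
proof
  interpret conv: pair_group "G\<inverse>" n N by (rule pair_group_converse)
  have r': "ell ^ r dvd trace g2 ^ 2 - trace g1 ^ 2" "\<not> ell ^ Suc r dvd trace g2 ^ 2 - trace g1 ^ 2"
    using r by (metis dvd_minus_iff minus_diff_eq)+
  fix p assume "p \<in> (BB2 (2 * r + 5 * n + 1) (2 * r + 5 * n + 1) :: ('l zp_mat \<times> 'l zp_mat) set)"
  then obtain x y where p: "p = (x, y)" "x \<in> BB (2 * r + 5 * n + 1)" "y \<in> BB (2 * r + 5 * n + 1)"
    by (auto simp: BB2_def)
  have "(mat 1, y) \<in> G" using kernel_contains_BB_of_discrepancy[OF g r p(3)] .
  moreover have "(x, mat 1) \<in> G"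
    using conv.kernel_contains_BB_of_discrepancy[of g2 g1 r x] g r' p(2) by simp
  ultimately show "p \<in> G" using mult[of x "mat 1" "mat 1" y] by (simp add: p)
qed

end

section \<open>Small trace discrepancies: the sign character\<close>

lemma ell_power_dvd_square:
  fixes x :: "'l :: prime_card zp"
  assumes "ell ^ (2 * a) dvd x ^ 2"
  shows "ell ^ a dvd x"
proof (rule ccontr)
  assume *: "\<not> ell ^ a dvd x"
  then have a: "a \<ge> 1" by (cases a) auto
  then have "\<not> ell ^ Suc (a - 1) dvd x" using * by simp
  then have "ell ^ (2 * a - (a - 1)) dvd x"
    using ell_power_dvd_cancel[of "2 * a" x x "a - 1"] assms by (simp add: power2_eq_square)
  then have "ell ^ a dvd x" by (rule ell_power_mono[rotated]) simp
  with * show False ..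
qed

lemma smult_pair_simp [simp]: "smult_pair c (u, v) = (smult_mat c u, smult_mat c v)"
  by (simp add: smult_pair_def)

lemma subspace_trace_form:
  fixes a b :: "'l :: prime_card zp_mat"
  shows "zp_pair.subspace {l. ell ^ m dvd trace (a ** fst l) * c - trace (b ** snd l) * d}"
    (is "zp_pair.subspace ?S")
proof (rule zp_pair.subspaceI)
  show "0 \<in> ?S" by (simp add: trace_2 matrix_mult_nth_2)
next
  fix p q assume "p \<in> ?S" "q \<in> ?S"
  then have "ell ^ m dvd (trace (a ** fst p) * c - trace (b ** snd p) * d)
      + (trace (a ** fst q) * c - trace (b ** snd q) * d)"
    by (auto intro: dvd_add)
  then show "p + q \<in> ?S" by (simp add: matrix_add_ldistrib trace_2 algebra_simps)
next
  fix k p assume "p \<in> ?S"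
  then have "ell ^ m dvd k * (trace (a ** fst p) * c - trace (b ** snd p) * d)" by auto
  then show "smult_pair k p \<in> ?S" by (cases p) (simp add: trace_2 algebra_simps)
qed

lemma trace_mult_square:
  "trace (g ** (x ** x)) = trace x * trace (g ** x) - det x * trace (g :: 'l :: prime_card zp_mat)"
  by (simp add: entries algebra_simps)

lemma nilpotent_BB:
  "lev m (mat2 0 1 0 0) \<in> BB m" "lev m (mat2 0 0 1 0) \<in> BB m" "lev m (mat2 1 1 (- 1) (- 1)) \<in> BB m"
  by (auto simp: BB_iff mcong_1_iff_lev) (simp_all add: lev_def det_2 algebra_simps)

text \<open>The remaining case: all squared traces agree to a precision \<open>r\<close> which is large compared to \<open>n\<close>.
  Then the traces themselves agree up to a sign, and the aim is to choose this sign multiplicatively in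
  \<open>g\<close>.\<close>

locale small_discrepancy = pair_group G n N
  for G :: "('l :: prime_card zp_mat \<times> 'l zp_mat) set" and n N +
  fixes r :: nat
  assumes discrepancy: "\<And>a b. (a, b) \<in> G \<Longrightarrow> ell ^ r dvd trace a ^ 2 - trace b ^ 2"
    and r_large: "4 * n + 1 < r"
begin

lemma half: "(half_zp :: 'l zp) + half_zp = 1"
  using two_half_zp[OF odd] by (simp only: mult_2)

lemma not_ell_dvd_pow_2:
  "\<not> (ell :: 'l zp) dvd 2" "\<not> (ell :: 'l zp) dvd 4" "\<not> (ell :: 'l zp) dvd 8"
proof -
  show 2: "\<not> (ell :: 'l zp) dvd 2" by (rule not_ell_dvd_2[OF odd])
  then show 4: "\<not> (ell :: 'l zp) dvd 4" using ell_dvd_mult_iff[of "2 :: 'l zp" 2] by simp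
  then show "\<not> (ell :: 'l zp) dvd 8" using 2 ell_dvd_mult_iff[of "2 :: 'l zp" 4] by simp
qed

text \<open>The subgroup on which the sign is visibly 1, since both traces are 2 modulo \<open>\<ell>\<close>. The second coordinate
  is only asked to be unipotent modulo \<open>\<ell>\<close>, so that the first projection contains all of
  \<open>B(n)\<close>.\<close>

definition P :: "('l zp_mat \<times> 'l zp_mat) set" where
  "P = {(x, y). (x, y) \<in> G \<and> det x = 1 \<and> mcong 1 x (mat 1) \<and> ell dvd trace y - 2}"

lemma trace_1: "trace (mat 1 :: 'l zp_mat) = 2"
  by (simp add: trace_2)

lemma discrepancy_mod_ell: "(a, b) \<in> G \<Longrightarrow> ell dvd trace a ^ 2 - trace b ^ 2"
  using discrepancy[of a b] r_large ell_power_mono[of 1 r] by simp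

lemma trace_cong_pm_2:
  assumes "(x, y) \<in> G" "mcong 1 x (mat 1)"
  shows "ell dvd trace y - 2 \<or> ell dvd trace y + 2"
proof -
  have "ell dvd trace x - 2" using mcong_trace[OF assms(2)] by (simp add: trace_1)
  then have "ell dvd (trace x - 2) * (trace x + 2) - (trace x ^ 2 - trace y ^ 2)"
    using discrepancy_mod_ell[OF assms(1)] by (simp only: dvd_diff dvd_mult2)
  also have "(trace x - 2) * (trace x + 2) - (trace x ^ 2 - trace y ^ 2) = (trace y - 2) * (trace y + 2)"
    by (simp add: power2_eq_square algebra_simps)
  finally show ?thesis by (simp add: ell_dvd_mult_iff)
qed

lemma P_D:
  assumes "(x, y) \<in> P"
  shows "(x, y) \<in> G" "det x = 1" "det y = 1" "mcong 1 x (mat 1)" "ell dvd trace x - 2" "ell dvd trace y - 2"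
proof -
  show *: "(x, y) \<in> G" "det x = 1" "mcong 1 x (mat 1)" "ell dvd trace y - 2" using assms by (auto simp: P_def)
  show "det y = 1" using det_eq[OF *(1)] *(2) by simp
  show "ell dvd trace x - 2" using mcong_trace[OF *(3)] by (simp add: trace_1)
qed

lemma P_adj2: "(x, y) \<in> P \<Longrightarrow> (adj2 x, adj2 y) \<in> P"
  using adj2_mem[of x y] mcong_adj2[of 1 x "mat 1"] by (auto simp: P_def)

text \<open>The traces of \<open>y ** y'\<close> and \<open>y ** adj2 y'\<close> are \<open>\<plusminus> 2\<close> modulo \<open>\<ell>\<close> and add up to 4.
  For odd \<open>\<ell>\<close> both are 2.\<close>

lemma P_mult:
  assumes "(x, y) \<in> P" "(x', y') \<in> P"
  shows "(x ** x', y ** y') \<in> P"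
proof -
  note 1 = P_D[OF assms(1)] and 2 = P_D[OF assms(2)] and 3 = P_D[OF P_adj2[OF assms(2)]]
  have m: "mcong 1 (x ** x') (mat 1)" "mcong 1 (x ** adj2 x') (mat 1)"
    using mcong_mult[OF 1(4) 2(4)] mcong_mult[OF 1(4) 3(4)] by simp_all
  note pm = trace_cong_pm_2[OF mult[OF 1(1) 2(1)] m(1)] trace_cong_pm_2[OF mult[OF 1(1) 3(1)] m(2)]
  have "ell dvd (trace y - 2) * trace y' + 2 * (trace y' - 2)"
    using 1(6) 2(6) by (intro dvd_add dvd_mult dvd_mult2)
  moreover have "(trace y - 2) * trace y' + 2 * (trace y' - 2)
      = trace (y ** y') + trace (y ** adj2 y') - 4"
    unfolding trace_mult_adj2 by (simp add: algebra_simps)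
  ultimately have sum: "ell dvd trace (y ** y') + trace (y ** adj2 y') - 4" by (simp only:)
  have "\<not> ell dvd trace (y ** y') + 2"
  proof
    assume *: "ell dvd trace (y ** y') + 2"
    from pm(2) show False
    proof
      assume "ell dvd trace (y ** adj2 y') - 2"
      from dvd_diff[OF dvd_add[OF * this] sum] show False using not_ell_dvd_pow_2 by simp
    next
      assume "ell dvd trace (y ** adj2 y') + 2"
      from dvd_diff[OF dvd_add[OF * this] sum] show False using not_ell_dvd_pow_2 by simp
    qed
  qed
  then show ?thesis using pm(1) m(1) mult[OF 1(1) 2(1)] 1(2) 2(2) by (simp add: P_def det_mul)
qed

lemma P_one: "(mat 1, mat 1) \<in> P"
  using one by (simp add: P_def trace_1 det_I)

lemma P_trace:
  assumes "(x, y) \<in> P"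
  shows "ell ^ r dvd trace x - trace y"
proof -
  note * = P_D[OF assms]
  have "\<not> ell dvd trace x + trace y"
  proof
    assume "ell dvd trace x + trace y"
    from dvd_diff[OF this dvd_add[OF *(5,6)]] show False using not_ell_dvd_pow_2 by simp
  qed
  moreover have "ell ^ r dvd (trace x + trace y) * (trace x - trace y)"
    using discrepancy[OF *(1)] by (simp add: power2_eq_square algebra_simps)
  ultimately show ?thesis using ell_power_dvd_cancel_unit by blast
qed

text \<open>The squares of the traces of \<open>g\<close>, \<open>g p\<close> and \<open>g p\<^sup>2\<close> agree in both coordinates.
  Expanding the last by the Cayley-Hamilton theorem leaves the product of the traces of \<open>g\<close> and
  \<open>g p\<close>.\<close>

lemma trace_product_1:
  assumes g: "(g1, g2) \<in> G" and p: "(x, y) \<in> P"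
  shows "ell ^ r dvd trace (g1 ** x) * trace g1 - trace (g2 ** y) * trace g2"
proof -
  note * = P_D[OF p]
  define T A B T' A' B' where defs: "T = trace x" "A = trace (g1 ** x)" "B = trace g1"
    "T' = trace y" "A' = trace (g2 ** y)" "B' = trace g2"
  have 1: "ell ^ r dvd T - T'" using P_trace[OF p] by (simp add: defs)
  have 2: "ell ^ r dvd A ^ 2 - A' ^ 2" "ell ^ r dvd B ^ 2 - B' ^ 2"
    using discrepancy[OF mult[OF g *(1)]] discrepancy[OF g] by (simp_all add: defs)
  have 3: "ell ^ r dvd (T * A - B) ^ 2 - (T' * A' - B') ^ 2"
    using discrepancy[OF mult[OF g mult[OF *(1) *(1)]]] *(2,3)
    by (simp add: trace_mult_square defs)
  have "2 * T * (A * B - A' * B') = T ^ 2 * (A ^ 2 - A' ^ 2) + (T - T') * ((T + T') * A' ^ 2)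
      + (B ^ 2 - B' ^ 2) - ((T * A - B) ^ 2 - (T' * A' - B') ^ 2) - (T - T') * (2 * A' * B')"
    by (simp add: power2_eq_square algebra_simps)
  also have "ell ^ r dvd \<dots>"
    using 1 2 3 by (simp only: dvd_diff dvd_add dvd_mult dvd_mult2)
  finally have "ell ^ r dvd (2 * T) * (A * B - A' * B')" .
  moreover have "\<not> ell dvd 2 * T"
  proof
    assume "ell dvd 2 * T"
    then have "ell dvd T" using not_ell_dvd_pow_2 by (simp add: ell_dvd_mult_iff)
    from dvd_diff[OF this *(5)] show False using not_ell_dvd_pow_2 by (simp add: defs)
  qed
  ultimately show ?thesis unfolding defs(2,3,5,6)[symmetric] by (rule ell_power_dvd_cancel_unit)
qed

lemma trace_product_P:
  assumes g: "(g1, g2) \<in> G" and p: "(x, y) \<in> P" and q: "(x', y') \<in> P"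
  shows "ell ^ r dvd trace (g1 ** x) * trace (g1 ** x') - trace (g2 ** y) * trace (g2 ** y')"
proof -
  note * = P_D[OF p]
  have "(adj2 x ** x', adj2 y ** y') \<in> P" using P_mult[OF P_adj2[OF p] q] .
  from trace_product_1[OF mult[OF g *(1)] this]
  have "ell ^ r dvd trace (g1 ** x ** adj2 x ** x') * trace (g1 ** x)
      - trace (g2 ** y ** adj2 y ** y') * trace (g2 ** y)"
    by (simp add: matrix_mul_assoc)
  moreover have "g1 ** x ** adj2 x ** x' = g1 ** x'" "g2 ** y ** adj2 y ** y' = g2 ** y'"
    using *(2,3) unfolding matrix_mul_assoc[symmetric, of _ x "adj2 x"] matrix_mul_assoc[symmetric, of _ y "adj2 y"]
    by (simp_all add: adj2_mult_det_1)
  ultimately show ?thesis by (simp add: mult.commute)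
qed

text \<open>The algebra spanned by \<open>P\<close>. A sign for \<open>g\<close> alone would be ambiguous when its trace is divisible
  by a high power of \<open>\<ell>\<close>; comparing \<open>tr(g\<^sub>1 u)\<close> with \<open>tr(g\<^sub>2 v)\<close> for all
  \<open>(u, v) \<in> \<Lambda>\<close> makes it unique.\<close>

definition \<Lambda> :: "('l zp_mat \<times> 'l zp_mat) set" where
  "\<Lambda> = zp_pair.span P"

lemma \<Lambda>_induct:
  assumes "(u, v) \<in> \<Lambda>"
    and "\<And>x y. (x, y) \<in> P \<Longrightarrow> ell ^ m dvd trace (a ** x) * c - trace (b ** y) * d"
  shows "ell ^ m dvd trace (a ** u) * c - trace (b ** v) * d"
proof -
  have "(u, v) \<in> {l. ell ^ m dvd trace (a ** fst l) * c - trace (b ** snd l) * d}"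
    using assms(1) unfolding \<Lambda>_def
    by (rule zp_pair.span_induct[where P = "\<lambda>p. p \<in> {l. ell ^ m dvd trace (a ** fst l) * c - trace (b ** snd l) * d}"])
      (use subspace_trace_form[of m a c b d] assms(2) in auto)
  then show ?thesis by simp
qed

lemma P_subset_\<Lambda>: "p \<in> P \<Longrightarrow> p \<in> \<Lambda>"
  unfolding \<Lambda>_def by (rule zp_pair.span_base)

lemma trace_product_\<Lambda>:
  assumes g: "(g1, g2) \<in> G" and p: "(u, v) \<in> \<Lambda>" and q: "(u', v') \<in> \<Lambda>"
  shows "ell ^ r dvd trace (g1 ** u) * trace (g1 ** u') - trace (g2 ** v) * trace (g2 ** v')"
proof (rule \<Lambda>_induct[OF p])
  fix x y assume p: "(x, y) \<in> P"
  have "ell ^ r dvd trace (g1 ** u') * trace (g1 ** x) - trace (g2 ** v') * trace (g2 ** y)"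
    by (rule \<Lambda>_induct[OF q]) (rule trace_product_P[OF g _ p])
  then show "ell ^ r dvd trace (g1 ** x) * trace (g1 ** u') - trace (g2 ** y) * trace (g2 ** v')"
    by (simp add: mult.commute)
qed

lemma trace_\<Lambda>: "(u, v) \<in> \<Lambda> \<Longrightarrow> ell ^ r dvd trace u - trace v"
  using \<Lambda>_induct[of u v r "mat 1" 1 "mat 1" 1] P_trace by simp

lemma \<Lambda>_mult:
  assumes p: "(x, y) \<in> P" and l: "(u, v) \<in> \<Lambda>"
  shows "(x ** u, y ** v) \<in> \<Lambda>"
proof -
  have "(x ** fst (u, v), y ** snd (u, v)) \<in> zp_pair.span P"
    using l unfolding \<Lambda>_def
  proof (rule zp_pair.span_induct)
    show "zp_pair.subspace {l. (x ** fst l, y ** snd l) \<in> zp_pair.span P}"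
    proof (rule zp_pair.subspaceI)
      have "x ** 0 = 0" "y ** 0 = 0" by (simp_all add: entries)
      then show "0 \<in> {l. (x ** fst l, y ** snd l) \<in> zp_pair.span P}"
        using zp_pair.span_zero[of P] by (simp add: zero_prod_def)
    next
      fix p q assume "p \<in> {l. (x ** fst l, y ** snd l) \<in> zp_pair.span P}"
        "q \<in> {l. (x ** fst l, y ** snd l) \<in> zp_pair.span P}"
      then have "(x ** fst p, y ** snd p) + (x ** fst q, y ** snd q) \<in> zp_pair.span P"
        by (simp only: mem_Collect_eq zp_pair.span_add)
      then show "p + q \<in> {l. (x ** fst l, y ** snd l) \<in> zp_pair.span P}"
        by (simp add: matrix_add_ldistrib)
    next
      fix c p assume "p \<in> {l. (x ** fst l, y ** snd l) \<in> zp_pair.span P}"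
      then have "smult_pair c (x ** fst p, y ** snd p) \<in> zp_pair.span P"
        by (auto intro: zp_pair.span_scale simp del: smult_pair_simp)
      then show "smult_pair c p \<in> {l. (x ** fst l, y ** snd l) \<in> zp_pair.span P}"
        by (cases p) simp
    qed
  next
    fix q assume "q \<in> P"
    then show "(x ** fst q, y ** snd q) \<in> zp_pair.span P"
      using P_mult[OF p, of "fst q" "snd q"] by (auto intro: zp_pair.span_base)
  qed
  then show ?thesis by (simp add: \<Lambda>_def)
qed

text \<open>Squares of lifts suffice here, because the trace of a lift is \<open>\<plusminus> 2\<close> modulo \<open>\<ell>\<close>. So,
  unlike in the general lifting lemma, no level is lost.\<close>

lemma P_proj1:
  assumes "x \<in> BB n"
  shows "\<exists>y. (x, y) \<in> P"
proof -
  have "BB n \<subseteq> {x. \<exists>y. (x, y) \<in> P}"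
  proof (rule BB_subset_by_leading_terms)
    show "x ** y \<in> {x. \<exists>y. (x, y) \<in> P}"
      if "x \<in> {x. \<exists>y. (x, y) \<in> P}" "y \<in> {x. \<exists>y. (x, y) \<in> P}" for x y
      using that P_mult by blast
  next
    show "BB (max N 1) \<subseteq> {x. \<exists>y. (x, y) \<in> P}"
    proof
      fix x assume "x \<in> (BB (max N 1) :: 'l zp_mat set)"
      then have "x \<in> BB N" "x \<in> BB 1" using BB_antimono[of _ "max N 1"] by (meson max.cobounded1 max.cobounded2 subsetD)+
      then have "(x, mat 1) \<in> P" using level[of x "mat 1"] by (auto simp: P_def BB_iff trace_1 det_I)
      then show "x \<in> {x. \<exists>y. (x, y) \<in> P}" by blast
    qed
  next
    fix m and u :: "'l zp_mat" assume m: "n \<le> m" and u: "trace u = 0"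
    then have m1: "m \<ge> 1" using n_pos by simp
    have "trace (smult_mat half_zp u) = 0" using u by (simp add: trace_2 flip: distrib_left)
    then obtain x0 where x0: "x0 \<in> BB m" "mcong (2 * m) x0 (lev m (smult_mat half_zp u))"
      using sl2_lift[OF _ m1] by blast
    obtain y0 where y0: "(x0, y0) \<in> G" using proj1 x0(1) BB_antimono[OF m] by blast
    have dx: "det x0 = 1" "det y0 = 1" using x0(1) det_eq[OF y0] by (auto simp: BB_iff)
    have x01: "mcong 1 x0 (mat 1)" using x0(1) m1 by (auto simp: BB_iff intro: mcong_mono)
    have "trace (y0 ** y0) - 2 = (trace y0 - 2) * (trace y0 + 2)"
      using trace_mult_square[of "mat 1" y0] dx by (simp add: trace_1 algebra_simps)
    then have "ell dvd trace (y0 ** y0) - 2"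
      using trace_cong_pm_2[OF y0 x01] by (simp add: ell_dvd_mult_iff)
    moreover have "mcong 1 (x0 ** x0) (mat 1)" using mcong_mult[OF x01 x01] by simp
    ultimately have "(x0 ** x0, y0 ** y0) \<in> P" using mult[OF y0 y0] dx by (simp add: P_def det_mul)
    moreover have "mcong (m + 1) (x0 ** x0) (lev m u)"
    proof -
      have "mcong (m + 1) x0 (lev m (smult_mat half_zp u))" by (rule mcong_mono[OF _ x0(2)]) (use m1 in simp)
      then have "mcong (m + 1) (x0 ** x0) (lev m (smult_mat half_zp u + smult_mat half_zp u))"
        using leading_mult[OF m1] by blast
      moreover have "smult_mat half_zp u + smult_mat half_zp u = u"
        using half by (simp add: entries flip: distrib_right)
      ultimately show ?thesis by simp
    qed
    ultimately show "\<exists>x\<in>{x. \<exists>y. (x, y) \<in> P}. det x = 1 \<and> mcong (m + 1) x (lev m u)"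
      using dx by (intro bexI[of _ "x0 ** x0"]) (auto simp: det_mul)
  qed (use n_pos in simp)
  with assms show ?thesis by blast
qed

lemma P_proj2:
  assumes "y \<in> BB (n + 1)"
  shows "\<exists>x. (x, y) \<in> P"
proof -
  obtain x where x: "x \<in> BB 1" "(x, y) \<in> G" using lift2[of 1 y] assms by (auto simp: add.commute)
  have "mcong 1 y (mat 1)" using assms mcong_mono[of 1 "n + 1" y "mat 1"] by (simp add: BB_iff)
  then have "ell dvd trace y - 2" using mcong_trace by (fastforce simp: trace_1)
  with x have "(x, y) \<in> P" by (simp add: P_def BB_iff)
  then show ?thesis ..
qed

text \<open>Multiplied by \<open>\<ell>\<^sup>n\<close> and added to 1, the three nilpotent matrices used here have determinant
  exactly 1. Together with 1 they span all matrices, as 2 is a unit.\<close>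

lemma \<Lambda>_contains_scaled: "\<exists>v. (smult_mat (ell ^ n) M, v) \<in> \<Lambda>"
proof -
  define S where "S = {M. \<exists>v. (smult_mat (ell ^ n) M, v) \<in> \<Lambda>}"
  have add: "A + B \<in> S" if AB: "A \<in> S" "B \<in> S" for A B
  proof -
    obtain v w where vw: "(smult_mat (ell ^ n) A, v) \<in> \<Lambda>" "(smult_mat (ell ^ n) B, w) \<in> \<Lambda>"
      using AB by (auto simp: S_def)
    have "(smult_mat (ell ^ n) A, v) + (smult_mat (ell ^ n) B, w) \<in> \<Lambda>"
      using vw unfolding \<Lambda>_def by (rule zp_pair.span_add)
    then show ?thesis by (auto simp: S_def smult_mat_add)
  qed
  have scale: "smult_mat c A \<in> S" if A: "A \<in> S" for c A
  proof -
    obtain v where v: "(smult_mat (ell ^ n) A, v) \<in> \<Lambda>" using A by (auto simp: S_def)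
    have "smult_pair c (smult_mat (ell ^ n) A, v) \<in> \<Lambda>"
      using v unfolding \<Lambda>_def by (rule zp_pair.span_scale)
    then show ?thesis by (auto simp: S_def mult.commute)
  qed
  have one_S: "mat 1 \<in> S"
  proof -
    have "smult_pair (ell ^ n) (mat 1, mat 1) \<in> \<Lambda>"
      using P_one unfolding \<Lambda>_def by (intro zp_pair.span_scale zp_pair.span_base)
    then show ?thesis by (auto simp: S_def)
  qed
  have lev_S: "A \<in> S" if A: "lev n A \<in> BB n" for A
  proof -
    obtain y where "(lev n A, y) \<in> P" using P_proj1[OF A] by blast
    then have "(lev n A, y) - (mat 1, mat 1) \<in> \<Lambda>"
      unfolding \<Lambda>_def using P_one by (intro zp_pair.span_diff zp_pair.span_base)
    then show ?thesis by (auto simp: S_def lev_def)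
  qed
  define \<alpha> \<delta> where "\<alpha> = half_zp * (M $ 1 $ 1 + M $ 2 $ 2)" and "\<delta> = half_zp * (M $ 1 $ 1 - M $ 2 $ 2)"
  have "\<alpha> + \<delta> = (half_zp + half_zp) * M $ 1 $ 1" "\<alpha> - \<delta> = (half_zp + half_zp) * M $ 2 $ 2"
    by (simp_all add: \<alpha>_def \<delta>_def algebra_simps)
  then have "\<alpha> + \<delta> = M $ 1 $ 1" "\<alpha> - \<delta> = M $ 2 $ 2" by (simp_all add: half)
  then have "M = smult_mat \<alpha> (mat 1) + smult_mat (M $ 1 $ 2 - \<delta>) (mat2 0 1 0 0)
      + smult_mat (M $ 2 $ 1 + \<delta>) (mat2 0 0 1 0) + smult_mat \<delta> (mat2 1 1 (- 1) (- 1))"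
    by (simp add: entries)
  moreover have "\<dots> \<in> S"
    by (intro add scale one_S lev_S[OF nilpotent_BB(1)] lev_S[OF nilpotent_BB(2)] lev_S[OF nilpotent_BB(3)])
  ultimately show ?thesis by (auto simp: S_def)
qed

text \<open>Congruence modulo \<open>\<ell>\<^sup>m\<close> of the functionals \<open>tr(g\<^sub>1 \<cdot>)\<close> and \<open>\<epsilon> tr(g\<^sub>2 \<cdot>)\<close>
  on \<open>\<Lambda>\<close>.\<close>

definition sign_cong :: "nat \<Rightarrow> 'l zp \<Rightarrow> 'l zp_mat \<Rightarrow> 'l zp_mat \<Rightarrow> bool" where
  "sign_cong m \<epsilon> g1 g2 \<longleftrightarrow> (\<forall>(u, v)\<in>\<Lambda>. ell ^ m dvd trace (g1 ** u) - \<epsilon> * trace (g2 ** v))"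

lemma sign_congD: "sign_cong m \<epsilon> g1 g2 \<Longrightarrow> (u, v) \<in> \<Lambda> \<Longrightarrow> ell ^ m dvd trace (g1 ** u) - \<epsilon> * trace (g2 ** v)"
  by (auto simp: sign_cong_def)

lemma sign_cong_mono: "a \<le> b \<Longrightarrow> sign_cong b \<epsilon> g1 g2 \<Longrightarrow> sign_cong a \<epsilon> g1 g2"
  by (auto simp: sign_cong_def intro: ell_power_mono)

lemma trace_nonzero_on_\<Lambda>:
  assumes "(g1, g2) \<in> G"
  obtains u v where "(u, v) \<in> \<Lambda>" "\<not> ell ^ Suc n dvd trace (g1 ** u)" "\<not> ell ^ Suc n dvd 2 * trace (g1 ** u)"
proof -
  obtain v where v: "(smult_mat (ell ^ n) (adj2 g1), v) \<in> \<Lambda>" using \<Lambda>_contains_scaled by blast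
  obtain h1 where "g1 ** h1 = mat 1" using inverse[OF assms] by blast
  from arg_cong[OF this, of det] have "det g1 dvd 1" by (metis det_mul det_I dvd_triv_left)
  then have dg: "\<not> ell dvd det g1" by (simp add: is_unit_zp_iff)
  have "trace (g1 ** smult_mat (ell ^ n) (adj2 g1)) = ell ^ n * (2 * det g1)"
    by (simp add: adj2_mult trace_2)
  moreover have "\<not> ell ^ Suc n dvd ell ^ n * (2 * det g1)"
    using ell_power_le_of_dvd[of "Suc n" n "2 * det g1"] dg not_ell_dvd_pow_2 by (auto simp: ell_dvd_mult_iff)
  moreover have "\<not> ell ^ Suc n dvd 2 * (ell ^ n * (2 * det g1))"
    using ell_power_le_of_dvd[of "Suc n" n "2 * (2 * det g1)"] dg not_ell_dvd_pow_2
    by (auto simp: ell_dvd_mult_iff mult.left_commute)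
  ultimately show ?thesis using that[OF v] by simp
qed

lemma sign_cong_unique:
  assumes g: "(g1, g2) \<in> G" and "sign_cong (n + 1) \<epsilon> g1 g2" "sign_cong (n + 1) (- \<epsilon>) g1 g2"
  shows False
proof -
  obtain u v where uv: "(u, v) \<in> \<Lambda>" "\<not> ell ^ Suc n dvd 2 * trace (g1 ** u)"
    using trace_nonzero_on_\<Lambda>[OF g] by blast
  from dvd_add[OF sign_congD[OF assms(2) uv(1)] sign_congD[OF assms(3) uv(1)]] uv(2)
  show False by simp
qed

text \<open>Fix an element of \<open>\<Lambda>\<close> on which \<open>tr(g\<^sub>1 \<cdot>)\<close> has minimal valuation \<open>a\<close>. The congruence of
  squares determines \<open>tr(g\<^sub>2 \<cdot>)\<close> there up to a sign, and the congruence of products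
  propagates this sign to all of \<open>\<Lambda>\<close>. By minimality only \<open>a \<le> n\<close> levels are lost.\<close>

lemma sign_exists:
  assumes g: "(g1, g2) \<in> G"
  obtains \<epsilon> where "\<epsilon> = 1 \<or> \<epsilon> = - 1" "sign_cong (r - n) \<epsilon> g1 g2"
proof -
  define A where "A l = trace (g1 ** fst l)" for l :: "'l zp_mat \<times> 'l zp_mat"
  define A' where "A' l = trace (g2 ** snd l)" for l :: "'l zp_mat \<times> 'l zp_mat"
  have prod: "ell ^ r dvd A l * A m - A' l * A' m" if "l \<in> \<Lambda>" "m \<in> \<Lambda>" for l m
    using trace_product_\<Lambda>[OF g, of "fst l" "snd l" "fst m" "snd m"] that by (simp add: A_def A'_def)
  define Q where "Q a \<longleftrightarrow> (\<exists>l\<in>\<Lambda>. \<not> ell ^ Suc a dvd A l)" for a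
  define a where "a = (LEAST a. Q a)"
  have "Q n" using trace_nonzero_on_\<Lambda>[OF g] unfolding Q_def A_def by (metis fst_conv)
  then have Qa: "Q a" and an: "a \<le> n" unfolding a_def by (rule LeastI, rule Least_le)
  have A_dvd: "ell ^ a dvd A m" if "m \<in> \<Lambda>" for m
  proof (cases a)
    case (Suc b)
    then have "\<not> Q b" using not_less_Least[of b Q] by (simp add: a_def)
    then show ?thesis using that Suc by (auto simp: Q_def)
  qed simp
  have ar: "2 * a \<le> r" using an r_large by simp
  have A'_dvd: "ell ^ a dvd A' m" if "m \<in> \<Lambda>" for m
  proof (rule ell_power_dvd_square)
    have "ell ^ (2 * a) dvd A m * A m - A' m * A' m"
      using prod[OF that that] by (rule ell_power_mono[OF ar])
    moreover have "ell ^ (2 * a) dvd A m * A m"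
      using mult_dvd_mono[OF A_dvd[OF that] A_dvd[OF that]] by (simp add: mult_2 power_add)
    ultimately have "ell ^ (2 * a) dvd A m * A m - (A m * A m - A' m * A' m)" by (rule dvd_diff[rotated])
    then show "ell ^ (2 * a) dvd A' m ^ 2" by (simp add: power2_eq_square)
  qed
  obtain l where l: "l \<in> \<Lambda>" "\<not> ell ^ Suc a dvd A l" using Qa by (auto simp: Q_def)
  obtain w w' where w: "A l = ell ^ a * w" "A' l = ell ^ a * w'" using A_dvd[OF l(1)] A'_dvd[OF l(1)] by (elim dvdE)
  have wu: "\<not> ell dvd w"
  proof
    assume "ell dvd w"
    then have "ell ^ a * ell dvd A l" unfolding w by simp
    with l(2) show False by (simp add: mult.commute)
  qed
  have "ell ^ (2 * a) * ell ^ (r - 2 * a) dvd ell ^ (2 * a) * ((w - w') * (w + w'))"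
  proof -
    have "ell ^ (2 * a) * ((w - w') * (w + w')) = A l * A l - A' l * A' l"
      unfolding w mult_2 power_add by (simp add: algebra_simps)
    then show ?thesis using prod[OF l(1) l(1)] ar by (simp flip: power_add)
  qed
  then have ww: "ell ^ (r - 2 * a) dvd (w - w') * (w + w')" by (simp only: ell_power_cancel)
  obtain \<epsilon> where eps: "\<epsilon> = 1 \<or> \<epsilon> = - 1" "ell ^ (r - 2 * a) dvd w - \<epsilon> * w'"
  proof (cases "ell dvd w + w'")
    case True
    have "\<not> ell dvd w - w'"
    proof
      assume "ell dvd w - w'"
      from dvd_add[OF True this] have "ell dvd 2 * w" by simp
      then show False using wu not_ell_dvd_pow_2 by (simp add: ell_dvd_mult_iff)
    qed
    then have "ell ^ (r - 2 * a) dvd w - (- 1) * w'" using ell_power_dvd_cancel_unit[OF ww] by simp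
    then show ?thesis using that by blast
  next
    case False
    then have "ell ^ (r - 2 * a) dvd w - 1 * w'"
      using ell_power_dvd_cancel_unit[of "r - 2 * a" "w + w'" "w - w'"] ww by (simp add: mult.commute)
    then show ?thesis using that by blast
  qed
  have sq: "\<epsilon> * \<epsilon> = 1" using eps(1) by auto
  have Al: "ell ^ (r - a) dvd A l - \<epsilon> * A' l"
  proof -
    have "ell ^ a * ell ^ (r - 2 * a) dvd ell ^ a * (w - \<epsilon> * w')" using eps(2) by (simp only: ell_power_cancel)
    moreover have "ell ^ a * (w - \<epsilon> * w') = A l - \<epsilon> * A' l" by (simp add: w algebra_simps)
    moreover have "a + (r - 2 * a) = r - a" using ar by simp
    ultimately show ?thesis by (simp flip: power_add)
  qed
  have "ell ^ (r - n) dvd A m - \<epsilon> * A' m" if m: "m \<in> \<Lambda>" for m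
  proof -
    have "ell ^ a * ell ^ (r - a) dvd A' m * (A l - \<epsilon> * A' l)"
      by (rule mult_dvd_mono[OF A'_dvd[OF m] Al])
    then have "ell ^ r dvd A' m * (A l - \<epsilon> * A' l)" using ar by (simp flip: power_add)
    then have "ell ^ r dvd (A l * A m - A' l * A' m) - \<epsilon> * (A' m * (A l - \<epsilon> * A' l))"
      using prod[OF l(1) m] by (simp only: dvd_diff dvd_mult)
    also have "(A l * A m - A' l * A' m) - \<epsilon> * (A' m * (A l - \<epsilon> * A' l))
        = A l * (A m - \<epsilon> * A' m) + (\<epsilon> * \<epsilon> - 1) * (A' m * A' l)"
      by (simp add: algebra_simps)
    finally have "ell ^ r dvd A l * (A m - \<epsilon> * A' m)" by (simp add: sq)
    then have "ell ^ (r - a) dvd A m - \<epsilon> * A' m" using l(2) by (rule ell_power_dvd_cancel)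
    then show ?thesis by (rule ell_power_mono[rotated]) (use an in simp)
  qed
  then have "sign_cong (r - n) \<epsilon> g1 g2" by (auto simp: sign_cong_def A_def A'_def)
  with eps(1) that show ?thesis by blast
qed

lemma trace_form_nondegenerate:
  assumes "\<And>y :: 'l zp_mat. y \<in> BB (n + 1) \<Longrightarrow> ell ^ m dvd trace (Z ** y)"
  shows "mcong (m - (n + 1)) Z 0"
proof -
  let ?L = "ell ^ (n + 1) :: 'l zp"
  have one_BB: "mat 1 \<in> (BB (n + 1) :: 'l zp_mat set)" by (simp add: BB_iff det_I)
  have tr: "ell ^ m dvd trace Z" using assms[OF one_BB] by simp
  have nil: "ell ^ (m - (n + 1)) dvd trace (Z ** A)" if "lev (n + 1) A \<in> BB (n + 1)" for A
  proof -
    have "ell ^ m dvd trace (Z ** lev (n + 1) A) - trace Z" using assms[OF that] tr by (rule dvd_diff)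
    also have "trace (Z ** lev (n + 1) A) - trace Z = ?L * trace (Z ** A)"
      by (simp add: lev_def entries algebra_simps)
    finally have "ell ^ m dvd ?L * trace (Z ** A)" .
    moreover have "\<not> ell ^ Suc (n + 1) dvd ?L"
      using ell_power_le_of_dvd[of "Suc (n + 1)" "n + 1" "1 :: 'l zp"] not_ell_dvd_1[where ?'l = 'l] by auto
    ultimately show ?thesis by (rule ell_power_dvd_cancel)
  qed
  let ?m = "m - (n + 1)"
  have z21: "ell ^ ?m dvd Z $ 2 $ 1 - 0" using nil[OF nilpotent_BB(1)] by (simp add: entries)
  have z12: "ell ^ ?m dvd Z $ 1 $ 2 - 0" using nil[OF nilpotent_BB(2)] by (simp add: entries)
  have h: "ell ^ ?m dvd (Z $ 1 $ 1 - Z $ 1 $ 2) + (Z $ 2 $ 1 - Z $ 2 $ 2)"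
    using nil[OF nilpotent_BB(3)] by (simp add: entries)
  have t: "ell ^ ?m dvd Z $ 1 $ 1 + Z $ 2 $ 2"
    using tr ell_power_mono[of ?m m] by (simp add: trace_2)
  from dvd_add[OF dvd_diff[OF dvd_add[OF h z12] z21] t] have "ell ^ ?m dvd 2 * Z $ 1 $ 1" by (simp add: algebra_simps)
  then have z11: "ell ^ ?m dvd Z $ 1 $ 1" using not_ell_dvd_pow_2(1) by (rule ell_power_dvd_cancel_unit)
  with t have "ell ^ ?m dvd Z $ 2 $ 2" by (simp add: dvd_add_right_iff)
  with z11 z12 z21 show ?thesis by (simp add: mcong_def forall_2)
qed

text \<open>Up to the factor \<open>\<ell>\<^sup>n\<close> the first coordinate of \<open>g\<close> lies in the first projection of
  \<open>\<Lambda>\<close>. The sign of \<open>g\<close> then identifies the corresponding second coordinate by nondegeneracy of the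
  trace form, and the sign of \<open>h\<close> applies to this element of \<open>\<Lambda>\<close>.\<close>

lemma sign_cong_mult_weak:
  assumes g: "(g1, g2) \<in> G" and sg: "sign_cong (r - n) \<epsilon> g1 g2" and sh: "sign_cong (r - n) \<eta> h1 h2"
  shows "sign_cong (n + 1) (\<epsilon> * \<eta>) (g1 ** h1) (g2 ** h2)"
proof -
  let ?R = "r - n" and ?L = "ell ^ n :: 'l zp"
  have R: "?R \<le> r" "?R - (n + 1) \<le> ?R" "n + 1 \<le> ?R - (n + 1) - n" using r_large by auto
  obtain w where w: "(smult_mat ?L g1, w) \<in> \<Lambda>" using \<Lambda>_contains_scaled by blast
  have "mcong (?R - (n + 1)) (w - smult_mat (\<epsilon> * ?L) g2) 0"
  proof (rule trace_form_nondegenerate)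
    fix y assume "y \<in> (BB (n + 1) :: 'l zp_mat set)"
    then obtain x where p: "(x, y) \<in> P" using P_proj2 by blast
    have "ell ^ ?R dvd trace (x ** smult_mat ?L g1) - trace (y ** w)"
      using trace_\<Lambda>[OF \<Lambda>_mult[OF p w]] by (rule ell_power_mono[OF R(1)])
    moreover have "ell ^ ?R dvd ?L * (trace (g1 ** x) - \<epsilon> * trace (g2 ** y))"
      using sign_congD[OF sg P_subset_\<Lambda>[OF p]] by (rule dvd_mult)
    ultimately have "ell ^ ?R dvd ?L * (trace (g1 ** x) - \<epsilon> * trace (g2 ** y))
        - (trace (x ** smult_mat ?L g1) - trace (y ** w))"
      by (rule dvd_diff[rotated])
    also have "\<dots> = trace ((w - smult_mat (\<epsilon> * ?L) g2) ** y)"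
      by (simp add: entries algebra_simps)
    finally show "ell ^ ?R dvd trace ((w - smult_mat (\<epsilon> * ?L) g2) ** y)" .
  qed
  then have w_cong: "mcong (?R - (n + 1)) w (smult_mat (\<epsilon> * ?L) g2)" by (simp add: mcong_def)
  have "ell ^ (n + 1) dvd trace ((g1 ** h1) ** x) * 1 - trace ((g2 ** h2) ** y) * (\<epsilon> * \<eta>)"
    if p: "(x, y) \<in> P" for x y
  proof -
    let ?m = "?R - (n + 1)"
    have 1: "ell ^ ?m dvd trace (h1 ** (x ** smult_mat ?L g1)) - \<eta> * trace (h2 ** (y ** w))"
      using sign_congD[OF sh \<Lambda>_mult[OF p w]] by (rule ell_power_mono[OF R(2)])
    have "mcong ?m (h2 ** (y ** w)) (h2 ** (y ** smult_mat (\<epsilon> * ?L) g2))"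
      by (intro mcong_mult mcong_refl w_cong)
    then have 2: "ell ^ ?m dvd trace (h2 ** (y ** w)) - trace (h2 ** (y ** smult_mat (\<epsilon> * ?L) g2))"
      by (rule mcong_trace)
    have "ell ^ ?m dvd (trace (h1 ** (x ** smult_mat ?L g1)) - \<eta> * trace (h2 ** (y ** w)))
        + \<eta> * (trace (h2 ** (y ** w)) - trace (h2 ** (y ** smult_mat (\<epsilon> * ?L) g2)))"
      using 1 2 by (intro dvd_add dvd_mult)
    also have "\<dots> = ?L * trace (h1 ** (x ** g1)) - \<eta> * (\<epsilon> * ?L * trace (h2 ** (y ** g2)))"
      by (simp add: trace_2 algebra_simps)
    also have "trace (h1 ** (x ** g1)) = trace (g1 ** h1 ** x)"
      by (metis matrix_mul_assoc trace_mul_sym)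
    also have "trace (h2 ** (y ** g2)) = trace (g2 ** h2 ** y)"
      by (metis matrix_mul_assoc trace_mul_sym)
    also have "?L * trace (g1 ** h1 ** x) - \<eta> * (\<epsilon> * ?L * trace (g2 ** h2 ** y))
        = ?L * (trace (g1 ** h1 ** x) * 1 - trace (g2 ** h2 ** y) * (\<epsilon> * \<eta>))"
      by (simp add: algebra_simps)
    finally have "ell ^ (?m - n) dvd trace (g1 ** h1 ** x) * 1 - trace (g2 ** h2 ** y) * (\<epsilon> * \<eta>)"
      by (rule ell_power_dvd_cancel)
        (use ell_power_le_of_dvd[of "Suc n" n "1 :: 'l zp"] not_ell_dvd_1[where ?'l = 'l] in auto)
    then show ?thesis by (rule ell_power_mono[OF R(3)])
  qed
  then have "ell ^ (n + 1) dvd trace ((g1 ** h1) ** u) * 1 - trace ((g2 ** h2) ** v) * (\<epsilon> * \<eta>)"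
    if "(u, v) \<in> \<Lambda>" for u v
    using \<Lambda>_induct[OF that] by blast
  then show ?thesis by (auto simp: sign_cong_def mult.commute)
qed

text \<open>A sign is determined by its congruence modulo \<open>\<ell>\<^sup>n\<^sup>+\<^sup>1\<close>, so the precision lost in a
  product is recovered.\<close>

lemma sign_cong_upgrade:
  assumes g: "(g1, g2) \<in> G" and "\<epsilon> = 1 \<or> \<epsilon> = - 1" "sign_cong (n + 1) \<epsilon> g1 g2"
  shows "sign_cong (r - n) \<epsilon> g1 g2"
proof -
  obtain \<sigma> where s: "\<sigma> = 1 \<or> \<sigma> = - 1" "sign_cong (r - n) \<sigma> g1 g2" by (rule sign_exists[OF g])
  have "sign_cong (n + 1) \<sigma> g1 g2" by (rule sign_cong_mono[OF _ s(2)]) (use r_large in simp)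
  then have "\<sigma> \<noteq> - \<epsilon>" using sign_cong_unique[OF g assms(3)] by metis
  then have "\<sigma> = \<epsilon>" using s(1) assms(2) by auto
  with s(2) show ?thesis by simp
qed

lemma sign_cong_mult:
  assumes "(g1, g2) \<in> G" "(h1, h2) \<in> G" "\<epsilon> = 1 \<or> \<epsilon> = - 1" "\<eta> = 1 \<or> \<eta> = - 1"
    "sign_cong (r - n) \<epsilon> g1 g2" "sign_cong (r - n) \<eta> h1 h2"
  shows "sign_cong (r - n) (\<epsilon> * \<eta>) (g1 ** h1) (g2 ** h2)"
  using sign_cong_upgrade[OF mult[OF assms(1,2)] _ sign_cong_mult_weak[OF assms(1,5,6)]] assms(3,4) by auto

text \<open>The kernel of the sign character, of index at most 2 in \<open>G\<close>.\<close>

definition T :: "('l zp_mat \<times> 'l zp_mat) set" where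
  "T = {(g1, g2). (g1, g2) \<in> G \<and> sign_cong (r - n) 1 g1 g2}"

lemma T_or_sign_minus:
  assumes "(g1, g2) \<in> G"
  shows "(g1, g2) \<in> T \<or> sign_cong (r - n) (- 1) g1 g2"
  using sign_exists[OF assms] assms by (auto simp: T_def)

lemma T_mult: "(g1, g2) \<in> T \<Longrightarrow> (h1, h2) \<in> T \<Longrightarrow> (g1 ** h1, g2 ** h2) \<in> T"
  using sign_cong_mult[of g1 g2 h1 h2 1 1] mult by (simp add: T_def)

lemma T_mult_compl:
  "(g1, g2) \<in> G - T \<Longrightarrow> (h1, h2) \<in> G - T \<Longrightarrow> (g1 ** h1, g2 ** h2) \<in> T"
  using sign_cong_mult[of g1 g2 h1 h2 "- 1" "- 1"] mult T_or_sign_minus by (fastforce simp: T_def)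

lemma P_subset_T:
  assumes "(x, y) \<in> P"
  shows "(x, y) \<in> T"
proof (rule ccontr)
  note * = P_D[OF assms]
  assume "(x, y) \<notin> T"
  then have "sign_cong (r - n) (- 1) x y" using T_or_sign_minus *(1) by blast
  from sign_congD[OF this P_subset_\<Lambda>[OF P_one]] have "ell ^ (r - n) dvd trace x + trace y" by simp
  then have "ell ^ 1 dvd trace x + trace y" by (rule ell_power_mono[rotated]) (use r_large in simp)
  then have "ell dvd trace x + trace y" by simp
  from dvd_diff[OF this dvd_add[OF *(5,6)]] show False using not_ell_dvd_pow_2 by simp
qed

lemma T_inverse:
  assumes "(g1, g2) \<in> T" "(h1, h2) \<in> G" "g1 ** h1 = mat 1" "g2 ** h2 = mat 1"
  shows "(h1, h2) \<in> T"
proof (rule ccontr)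
  assume "(h1, h2) \<notin> T"
  then have "sign_cong (r - n) (- 1) h1 h2" using T_or_sign_minus assms(2) by blast
  then have "sign_cong (r - n) (1 * (- 1)) (mat 1) (mat 1)"
    using sign_cong_mult[of g1 g2 h1 h2 1 "- 1"] assms by (simp add: T_def)
  moreover have "sign_cong (r - n) 1 (mat 1) (mat 1)" using P_subset_T[OF P_one] by (simp add: T_def)
  moreover have "n + 1 \<le> r - n" using r_large by simp
  ultimately show False using sign_cong_unique[OF one, of 1] sign_cong_mono by fastforce
qed

lemma T_trace:
  assumes "(g1, g2) \<in> T"
  shows "ell ^ (r - n) dvd trace g1 - trace g2"
proof -
  have "sign_cong (r - n) 1 g1 g2" using assms by (simp add: T_def)
  from sign_congD[OF this P_subset_\<Lambda>[OF P_one]] show ?thesis by simp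
qed

text \<open>The traces on \<open>T\<close> agree modulo \<open>\<ell>\<^sup>r\<^sup>-\<^sup>n\<close>, so for every \<open>(x, y) \<in> T\<close> the functional
  \<open>(u, v) \<mapsto> tr(x u) - tr(y v)\<close> vanishes modulo this power on \<open>Lie_span T\<close>. For \<open>x\<close> unipotent of
  level \<open>n\<close> its value on a nilpotent element of the first summand has valuation \<open>n\<close>.\<close>

lemma Lie_span_T_bound:
  assumes "smult_mat (ell ^ k) ` sl2 \<times> smult_mat (ell ^ k) ` sl2 \<subseteq> Lie_span T"
  shows "r \<le> k + 2 * n"
proof -
  obtain y where xy: "(lev n (mat2 0 1 0 0), y) \<in> P" using P_proj1[OF nilpotent_BB(1)] by blast
  define x where "x = (lev n (mat2 0 1 0 0) :: 'l zp_mat)"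
  have xT: "(x, y) \<in> T" using xy P_subset_T by (simp add: x_def)
  have "mat2 0 0 1 0 \<in> (sl2 :: 'l zp_mat set)" "0 \<in> (sl2 :: 'l zp_mat set)"
    by (simp_all add: sl2_def trace_2)
  then have "(smult_mat (ell ^ k) (mat2 0 0 1 0), smult_mat (ell ^ k) 0) \<in> Lie_span T" using assms by blast
  then have "(smult_mat (ell ^ k) (mat2 0 0 1 0), smult_mat (ell ^ k) 0)
      \<in> {l. ell ^ (r - n) dvd trace (x ** fst l) * 1 - trace (y ** snd l) * 1}"
    unfolding Lie_span_def
  proof (rule zp_pair.span_induct[where P = "\<lambda>p. p \<in> {l. ell ^ (r - n) dvd trace (x ** fst l) * 1 - trace (y ** snd l) * 1}"])
    show "zp_pair.subspace (Collect (\<lambda>p. p \<in> {l. ell ^ (r - n) dvd trace (x ** fst l) * 1 - trace (y ** snd l) * 1}))"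
      using subspace_trace_form[of "r - n" x 1 y 1] by simp
  next
    fix p assume "p \<in> Theta2 ` T"
    then obtain g1 g2 where g: "(g1, g2) \<in> T" and p: "p = (Theta g1, Theta g2)" by (auto simp: Theta2_def)
    have tr: "trace (z ** Theta h) = trace (z ** h) - half_zp * (trace h * trace z)" for z h :: "'l zp_mat"
      by (simp add: Theta_def entries algebra_simps)
    have "ell ^ (r - n) dvd (trace (x ** g1) - trace (y ** g2))
        - half_zp * ((trace g1 - trace g2) * trace x + trace g2 * (trace x - trace y))"
      using T_trace[OF T_mult[OF xT g]] T_trace[OF g] T_trace[OF xT]
      by (simp only: dvd_diff dvd_mult dvd_add dvd_mult2)
    then show "p \<in> {l. ell ^ (r - n) dvd trace (x ** fst l) * 1 - trace (y ** snd l) * 1}"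
      by (simp add: p tr algebra_simps)
  qed
  then have "ell ^ (r - n) dvd ell ^ (k + n) * (1 :: 'l zp)"
    by (simp add: x_def lev_def entries power_add mult.commute)
  then have "r - n \<le> k + n" using not_ell_dvd_1 by (rule ell_power_le_of_dvd)
  then show ?thesis by simp
qed

end

section \<open>Open subgroups, index and reduction\<close>

lemma BB_sequence_tendsto:
  fixes X :: "nat \<Rightarrow> 'l :: prime_card zp_mat"
  assumes "\<And>k. X k \<in> BB k"
  shows "X \<longlonglongrightarrow> mat 1"
proof (intro vec_tendstoI topological_tendstoI)
  fix i j :: 2 and S :: "'l zp set"
  assume "open S" "mat 1 $ i $ j \<in> S"
  then obtain m where m: "\<And>y. zp_res y m = zp_res (mat 1 $ i $ j :: 'l zp) m \<Longrightarrow> y \<in> S"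
    unfolding open_zp_def by blast
  have "X k $ i $ j \<in> S" if "k \<ge> m" for k
  proof (rule m)
    have "ell ^ m dvd X k $ i $ j - mat 1 $ i $ j"
      using assms[of k] ell_power_mono[OF that] by (auto simp: BB_iff mcong_def)
    then have 0: "zp_res (X k $ i $ j - mat 1 $ i $ j) m = 0" by (simp add: ell_power_dvd_iff)
    have "zp_res ((X k $ i $ j - mat 1 $ i $ j) + mat 1 $ i $ j) m
        = (zp_res (X k $ i $ j - mat 1 $ i $ j) m + zp_res (mat 1 $ i $ j :: 'l zp) m) mod int CARD('l) ^ m"
      by (rule plus_zp.rep_eq[THEN fun_cong])
    then show "zp_res (X k $ i $ j) m = zp_res (mat 1 $ i $ j :: 'l zp) m"
      using zp_res_mod[of m m "mat 1 $ i $ j :: 'l zp"] by (simp add: 0)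
  qed
  then show "\<forall>\<^sub>F k in sequentially. X k $ i $ j \<in> S" by (auto simp: eventually_sequentially)
qed

lemma det_1_invertible: "det (A :: 'l :: prime_card zp_mat) = 1 \<Longrightarrow> invertible A"
  unfolding invertible_def using adj2_mult_det_1 by blast

lemma open_subgroup_contains_BB:
  fixes G :: "('l :: prime_card zp_mat \<times> 'l zp_mat) set"
  assumes G: "subgroup G (GL2 \<times>\<times> GL2)" and opn: "openin (top_of_set GL2_det_eq) G"
  obtains N where "\<And>x y. x \<in> BB N \<Longrightarrow> y \<in> BB N \<Longrightarrow> (x, y) \<in> G"
proof (rule ccontr)
  assume "\<not> thesis"
  then have "\<forall>k. \<exists>x y. x \<in> BB k \<and> y \<in> BB k \<and> (x, y) \<notin> G" using that by blast
  then obtain X Y where XY: "\<And>k. X k \<in> BB k" "\<And>k. Y k \<in> BB k" "\<And>k. (X k, Y k) \<notin> G" by metis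
  obtain U where U: "open U" "G = GL2_det_eq \<inter> U" using opn by (auto simp: openin_open)
  have "(mat 1, mat 1) \<in> G" using subgroup.one_closed[OF G] by simp
  then have "(mat 1, mat 1) \<in> U" using U by blast
  moreover have lim: "(\<lambda>k. (X k, Y k)) \<longlonglongrightarrow> (mat 1, mat 1)"
    by (intro tendsto_Pair BB_sequence_tendsto XY)
  ultimately obtain k where "(X k, Y k) \<in> U"
    using topological_tendstoD[OF lim U(1)] by (auto simp: eventually_sequentially)
  moreover have "(X k, Y k) \<in> GL2_det_eq"
    using XY(1,2)[of k] by (auto simp: GL2_det_eq_def BB_iff det_1_invertible)
  ultimately show False using XY(3)[of k] U by blast
qed

lemma (in group) card_rcosets_dvd_2:
  assumes T: "subgroup T G" and compl: "\<And>a b. a \<in> carrier G - T \<Longrightarrow> b \<in> carrier G - T \<Longrightarrow> a \<otimes> b \<in> T"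
  shows "card (rcosets T) dvd 2"
proof -
  have T_coset: "T #> a = T" if "a \<in> T" for a
    using coset_join2[OF _ T that] subgroup.mem_carrier[OF T that] by blast
  have eq: "T #> a = T #> b" if a: "a \<in> carrier G - T" and b: "b \<in> carrier G - T" for a b
  proof (rule repr_independence[OF _ _ T])
    have "inv a \<notin> T" using a subgroup.m_inv_closed[OF T, of "inv a"] by auto
    then have "b \<otimes> inv a \<in> T" using a by (intro compl b) auto
    then show "b \<in> T #> a" using subgroup.rcos_module[OF T is_group, of a b] a b by blast
  qed (use a in blast)
  define C where "C = T #> (SOME a. a \<in> carrier G - T)"
  have C: "T #> a = C" if "a \<in> carrier G - T" for a
    unfolding C_def by (rule eq[OF that]) (rule someI, rule that)
  have sub: "rcosets T \<subseteq> {T, C}"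
  proof
    fix X assume "X \<in> rcosets T"
    then obtain a where a: "a \<in> carrier G" "X = T #> a" by (auto simp: RCOSETS_def)
    show "X \<in> {T, C}" using T_coset[of a] C[of a] a by (cases "a \<in> T") simp_all
  qed
  have "T = T #> \<one>" using T_coset[OF subgroup.one_closed[OF T]] by simp
  then have "T \<in> rcosets T" unfolding RCOSETS_def by blast
  then have "card (rcosets T) \<ge> 1"
    using finite_subset[OF sub] by (auto simp: Suc_le_eq card_gt_0_iff)
  moreover have "card (rcosets T) \<le> 2"
    using card_mono[OF _ sub] card_insert_le_m1[of 2 "{C}" T] by simp
  ultimately have "card (rcosets T) = 1 \<or> card (rcosets T) = 2" by linarith
  then show ?thesis by auto
qed

lemma red_zp_eq_iff: "red_zp x = red_zp y \<longleftrightarrow> ell dvd x - (y :: 'l :: prime_card zp)"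
proof -
  have "red_zp x = red_zp y \<longleftrightarrow> zp_res x 1 = zp_res y 1"
    using zp_res_bounds[of x 1] zp_res_bounds[of y 1] unfolding red_zp_def
    by (metis power_one_right to_int_mod_ring_of_int_mod_ring)
  also have "\<dots> \<longleftrightarrow> int CARD('l) dvd zp_res x 1 - zp_res y 1"
    using zp_res_bounds[of x 1] zp_res_bounds[of y 1]
    by (metis mod_eq_dvd_iff mod_pos_pos_trivial power_one_right)
  also have "\<dots> \<longleftrightarrow> ell dvd x - y"
    by (simp add: ell_dvd_iff minus_zp.rep_eq dvd_eq_mod_eq_0)
  finally show ?thesis .
qed

lemma red_mat_nth: "red_mat t $ i $ j = red_zp (t $ i $ j)"
  by (simp add: red_mat_def map_matrix_def)

lemma red_mat_scalar:
  fixes t :: "'l :: prime_card zp_mat"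
  assumes "red_mat t = mat a"
  shows "ell dvd t $ 1 $ 2" "ell dvd t $ 2 $ 1" "ell dvd t $ 1 $ 1 - t $ 2 $ 2"
proof -
  have e: "red_zp (t $ i $ j) = mat a $ i $ j" for i j
    using arg_cong[OF assms, of "\<lambda>t. t $ i $ j"] by (simp add: red_mat_nth)
  have "red_zp (0 :: 'l zp) = 0" by (simp add: red_zp_def zero_zp.rep_eq)
  then have z: "ell dvd x \<longleftrightarrow> red_zp x = 0" for x :: "'l zp"
    using red_zp_eq_iff[of x 0] by simp
  show "ell dvd t $ 1 $ 2" "ell dvd t $ 2 $ 1" unfolding z e by simp_all
  show "ell dvd t $ 1 $ 1 - t $ 2 $ 2" unfolding red_zp_eq_iff[symmetric] e by simp
qed

lemma red_mat_scalar_eq: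
  fixes s t :: "'l :: prime_card zp_mat"
  assumes "CARD('l) > 2" "red_mat s = mat a" "red_mat t = mat b" "ell dvd trace s - trace t"
  shows "red_mat s = red_mat t"
proof -
  note s = red_mat_scalar[OF assms(2)] and t = red_mat_scalar[OF assms(3)]
  have "ell dvd (trace s - trace t) + (s $ 1 $ 1 - s $ 2 $ 2) - (t $ 1 $ 1 - t $ 2 $ 2)"
    using assms(4) s(3) t(3) by (simp only: dvd_add dvd_diff)
  also have "\<dots> = 2 * (s $ 1 $ 1 - t $ 1 $ 1)" by (simp add: trace_2 algebra_simps)
  finally have 11: "ell dvd s $ 1 $ 1 - t $ 1 $ 1"
    using not_ell_dvd_2[OF assms(1)] by (metis ell_dvd_mult_iff)
  have "ell dvd (s $ 1 $ 1 - t $ 1 $ 1) - (s $ 1 $ 1 - s $ 2 $ 2) + (t $ 1 $ 1 - t $ 2 $ 2)"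
    using 11 s(3) t(3) by (simp only: dvd_add dvd_diff)
  then have 22: "ell dvd s $ 2 $ 2 - t $ 2 $ 2" by simp
  show ?thesis
    unfolding mat_eq_iff_entries red_mat_nth red_zp_eq_iff using 11 22 s t by simp
qed

lemma subgroup_imp_pair_group:
  fixes G :: "('l :: prime_card zp_mat \<times> 'l zp_mat) set"
  assumes "CARD('l) > 2" and G: "subgroup G (GL2 \<times>\<times> GL2)"
    and "openin (top_of_set GL2_det_eq) G" and n: "n > 0"
    and "BB n \<subseteq> fst ` G" "BB n \<subseteq> snd ` G" and det: "\<forall>(g1, g2)\<in>G. det g1 = det g2"
  obtains N where "pair_group G n N"
proof -
  obtain N where N: "\<And>x y. x \<in> BB N \<Longrightarrow> y \<in> BB N \<Longrightarrow> (x, y) \<in> G"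
    using open_subgroup_contains_BB[OF assms(2,3)] by blast
  have grp: "group ((GL2 \<times>\<times> GL2) :: ('l zp_mat \<times> 'l zp_mat) monoid)"
    by (rule DirProd_group[OF group_GL2 group_GL2])
  have "pair_group G n N"
  proof
    show "(mat 1, mat 1) \<in> G" using subgroup.one_closed[OF G] by simp
    show "(a ** c, b ** d) \<in> G" if "(a, b) \<in> G" "(c, d) \<in> G" for a b c d
      using subgroup.m_closed[OF G that] by simp
    show "\<exists>c d. (c, d) \<in> G \<and> a ** c = mat 1 \<and> c ** a = mat 1 \<and> b ** d = mat 1 \<and> d ** b = mat 1"
      if ab: "(a, b) \<in> G" for a b
    proof -
      obtain c d where cd: "inv\<^bsub>GL2 \<times>\<times> GL2\<^esub> (a, b) = (c, d)" by fastforce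
      have m: "(a, b) \<in> carrier (GL2 \<times>\<times> GL2)" by (rule subgroup.mem_carrier[OF G ab])
      have "(c, d) \<in> G" using subgroup.m_inv_closed[OF G ab] cd by simp
      moreover have "(a ** c, b ** d) = (mat 1, mat 1)" using group.r_inv[OF grp m] cd by simp
      moreover have "(c ** a, d ** b) = (mat 1, mat 1)" using group.l_inv[OF grp m] cd by simp
      ultimately show ?thesis by blast
    qed
    show "\<exists>y. (x, y) \<in> G" if "x \<in> BB n" for x using assms(5) that by fastforce
    show "\<exists>x. (x, y) \<in> G" if "y \<in> BB n" for y using assms(6) that by fastforce
  qed (use assms(1) n det N in auto)
  then show ?thesis by (rule that)
qed

context pair_group
begin

text \<open>The pair of 1 and a matrix of determinant 1 and trace \<open>2 + L\<^sup>2\<close>, with \<open>L \<noteq> 0\<close> in the ideal of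
  level \<open>N\<close>. This is where openness guarantees that the traces cannot always agree.\<close>

lemma exists_discrepancy: "\<exists>(a, b)\<in>G. trace a ^ 2 - trace b ^ 2 \<noteq> 0"
proof -
  define L where "L = (ell ^ (N + 1) :: 'l zp)"
  define y where "y = lev (N + 1) (mat2 L 1 1 0)"
  have y: "y = mat 1 + smult_mat L (mat2 L 1 1 0)" by (simp only: y_def lev_def L_def)
  have "det y = 1" by (simp add: y det_2)
  moreover have "mcong N y (mat 1)"
    by (rule mcong_mono[of N "N + 1"]) (auto simp: y_def mcong_1_iff_lev)
  ultimately have "(mat 1, y) \<in> G" by (intro level) (auto simp: BB_iff det_I)
  moreover have "trace (mat 1 :: 'l zp_mat) ^ 2 - trace y ^ 2 = - (L ^ 2 * (4 + L ^ 2))"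
    by (simp add: y trace_2 power2_eq_square algebra_simps)
  moreover have "4 + L ^ 2 \<noteq> 0"
  proof
    assume *: "4 + L ^ 2 = 0"
    have "ell dvd L ^ 2" by (simp add: L_def power2_eq_square)
    with * have "(ell :: 'l zp) dvd 4" by (metis dvd_0_right dvd_add_left_iff)
    then show False using not_ell_dvd_2[OF odd] ell_dvd_mult_iff[of "2 :: 'l zp" 2] by simp
  qed
  moreover have "L \<noteq> 0" by (simp add: L_def del: of_nat_power)
  ultimately show ?thesis by (intro bexI[of _ "(mat 1, y)"]) auto
qed

lemma minimal_discrepancy:
  "\<exists>r. (\<exists>g1 g2. (g1, g2) \<in> G \<and> \<not> ell ^ Suc r dvd trace g1 ^ 2 - trace g2 ^ 2) \<and>
    (\<forall>a b. (a, b) \<in> G \<longrightarrow> ell ^ r dvd trace a ^ 2 - trace b ^ 2)"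
proof -
  define Q where "Q k \<longleftrightarrow> (\<exists>(a, b)\<in>G. \<not> ell ^ Suc k dvd trace a ^ 2 - trace b ^ 2)" for k
  obtain a b where ab: "(a, b) \<in> G" "trace a ^ 2 - trace b ^ 2 \<noteq> 0" using exists_discrepancy by blast
  then obtain k where "\<not> ell ^ k dvd trace a ^ 2 - trace b ^ 2" using zp_eq_0_iff by blast
  then have "\<not> ell ^ Suc k dvd trace a ^ 2 - trace b ^ 2" using ell_power_mono[of k "Suc k"] by auto
  then have "Q k" using ab(1) by (auto simp: Q_def)
  define r where "r = (LEAST k. Q k)"
  have "Q r" unfolding r_def using \<open>Q k\<close> by (rule LeastI)
  then obtain g1 g2 where "(g1, g2) \<in> G" "\<not> ell ^ Suc r dvd trace g1 ^ 2 - trace g2 ^ 2"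
    by (auto simp: Q_def simp del: power_Suc)
  moreover have "ell ^ r dvd trace a ^ 2 - trace b ^ 2" if "(a, b) \<in> G" for a b
  proof (cases r)
    case (Suc k)
    then have "\<not> Q k" using not_less_Least[of k Q] by (simp add: r_def)
    then show ?thesis using that Suc by (auto simp: Q_def)
  qed simp
  ultimately show ?thesis by blast
qed

end

theorem theorem3p1:
  fixes G :: "('l :: prime_card zp_mat \<times> 'l zp_mat) set"
    and n1 n2 :: nat
  assumes "CARD('l) > 2"
    and "subgroup G (GL2 \<times>\<times> GL2)"
    and "openin (top_of_set GL2_det_eq) G"
    and "n1 > 0" and "BB n1 \<subseteq> fst ` G"
    and "n2 > 0" and "BB n2 \<subseteq> snd ` G"
    and "\<forall>(g1, g2)\<in>G. det g1 = det g2"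
  shows "BB2 (20 * max n1 n2) (20 * max n1 n2) \<subseteq> G \<or>
    (\<exists>T. subgroup T ((GL2 \<times>\<times> GL2)\<lparr>carrier := G\<rparr>) \<and>
      card (rcosets\<^bsub>(GL2 \<times>\<times> GL2)\<lparr>carrier := G\<rparr>\<^esub> T) dvd 2 * 48 ^ 2 \<and>
      (\<forall>k::nat.
        smult_mat (of_nat CARD('l) ^ k) ` sl2 \<times> smult_mat (of_nat CARD('l) ^ k) ` sl2
          \<subseteq> Lie_span T \<longrightarrow>
        (let p = 2 * k + max (2 * k) (max (8 * n1) (8 * n2)) in BB2 p p \<subseteq> T)) \<and>
      (\<forall>(t1, t2)\<in>T.
        (\<exists>a. red_mat t1 = mat a) \<and> (\<exists>b. red_mat t2 = mat b) \<longrightarrow>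
          red_mat t1 = red_mat t2))"
proof -
  define n where "n = max n1 n2"
  have n: "n > 0" "BB n \<subseteq> fst ` G" "BB n \<subseteq> snd ` G"
    using assms(4-7) BB_antimono[of n1 n] BB_antimono[of n2 n] by (auto simp: n_def)
  obtain N where pg: "pair_group G n N"
    using subgroup_imp_pair_group[OF assms(1-3) n assms(8)] by blast
  interpret pair_group G n N by (rule pg)
  obtain r g1 g2 where g: "(g1, g2) \<in> G" "\<not> ell ^ Suc r dvd trace g1 ^ 2 - trace g2 ^ 2"
    and r: "\<And>a b. (a, b) \<in> G \<Longrightarrow> ell ^ r dvd trace a ^ 2 - trace b ^ 2"
    using minimal_discrepancy by metis
  define m where "m = 2 * r + 5 * n + 1"
  have m: "BB2 m m \<subseteq> G" unfolding m_def by (rule contains_BB2_of_discrepancy[OF g(1) r[OF g(1)] g(2)])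
  show ?thesis
  proof (cases "m \<le> 20 * n")
    case True
    then have "BB2 (20 * n) (20 * n) \<subseteq> G" using m BB_antimono[OF True] by (fastforce simp: BB2_def)
    then show ?thesis by (simp add: n_def)
  next
    case False
    then have r_big: "15 * n \<le> 2 * r" by (simp add: m_def)
    interpret small_discrepancy G n N r
      by unfold_locales (use r r_big n(1) in auto)
    let ?K = "(GL2 \<times>\<times> GL2)\<lparr>carrier := G\<rparr>"
    have grp: "group (GL2 \<times>\<times> GL2 :: ('l zp_mat \<times> 'l zp_mat) monoid)"
      by (rule DirProd_group[OF group_GL2 group_GL2])
    interpret K: group ?K by (rule subgroup.subgroup_is_group[OF assms(2) grp])
    have T: "subgroup T ?K"
    proof (rule K.subgroupI)
      show "T \<subseteq> carrier ?K" by (auto simp: T_def)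
      show "T \<noteq> {}" using P_subset_T[OF P_one] by blast
      show "p \<otimes>\<^bsub>?K\<^esub> q \<in> T" if "p \<in> T" "q \<in> T" for p q
        using that T_mult by (cases p, cases q) auto
      show "inv\<^bsub>?K\<^esub> p \<in> T" if p: "p \<in> T" for p
      proof -
        obtain a b c d where ab: "p = (a, b)" and cd: "inv\<^bsub>?K\<^esub> p = (c, d)" by fastforce
        have pG: "p \<in> carrier ?K" using p by (auto simp: T_def)
        have "(c, d) \<in> G" using K.inv_closed[OF pG] cd by simp
        moreover have "a ** c = mat 1" "b ** d = mat 1"
          using K.r_inv[OF pG, unfolded cd, unfolded ab] by simp_all
        ultimately have "(c, d) \<in> T" by (rule T_inverse[OF p[unfolded ab]])
        then show ?thesis by (simp only: cd)
      qed
    qed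
    have index: "card (rcosets\<^bsub>?K\<^esub> T) dvd 2 * 48 ^ 2"
    proof -
      have "card (rcosets\<^bsub>?K\<^esub> T) dvd 2"
        by (rule K.card_rcosets_dvd_2[OF T]) (use T_mult_compl in auto)
      then show ?thesis by (rule dvd_mult2)
    qed
    have BB2_T: "BB2 p p \<subseteq> T"
      if span: "smult_mat (ell ^ k) ` sl2 \<times> smult_mat (ell ^ k) ` sl2 \<subseteq> Lie_span T"
        and p: "p = 2 * k + max (2 * k) (max (8 * n1) (8 * n2))" for k p
    proof
      have "r \<le> k + 2 * n" by (rule Lie_span_T_bound[OF span])
      \<comment> \<open>\<open>p \<ge> 4 k \<ge> 4 r - 8 n \<ge> 2 r + 7 n \<ge> m\<close>, the third step by the failure of the first
        alternative\<close>
      then have mp: "m \<le> p" "1 \<le> p" using r_big n(1) by (auto simp: m_def p)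
      fix q assume "q \<in> (BB2 p p :: ('l zp_mat \<times> 'l zp_mat) set)"
      then obtain x y where q: "q = (x, y)" "x \<in> BB p" "y \<in> BB p" by (auto simp: BB2_def)
      have "(x, y) \<in> G" using q m BB_antimono[OF mp(1)] by (fastforce simp: BB2_def)
      moreover have "mcong 1 x (mat 1)" "mcong 1 y (mat 1)"
        using q(2,3) mp(2) by (auto simp: BB_iff intro: mcong_mono)
      moreover have "ell dvd trace y - 2" using mcong_trace[OF \<open>mcong 1 y (mat 1)\<close>] by (simp add: trace_1)
      ultimately have "(x, y) \<in> P" using q(2) by (simp add: P_def BB_iff)
      then show "q \<in> T" unfolding q(1) by (rule P_subset_T)
    qed
    have red: "red_mat t1 = red_mat t2"
      if "(t1, t2) \<in> T" "red_mat t1 = mat a" "red_mat t2 = mat b" for t1 t2 a b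
    proof (rule red_mat_scalar_eq[OF assms(1) that(2,3)])
      have "ell ^ 1 dvd trace t1 - trace t2"
        by (rule ell_power_mono[OF _ T_trace[OF that(1)]]) (use r_large in simp)
      then show "ell dvd trace t1 - trace t2" by simp
    qed
    show ?thesis
    proof (intro disjI2 exI[of _ T] conjI allI impI)
      show "subgroup T ?K" by (rule T)
      show "card (rcosets\<^bsub>?K\<^esub> T) dvd 2 * 48 ^ 2" by (rule index)
      show "let p = 2 * k + max (2 * k) (max (8 * n1) (8 * n2)) in BB2 p p \<subseteq> T"
        if "smult_mat (ell ^ k) ` sl2 \<times> smult_mat (ell ^ k) ` sl2 \<subseteq> Lie_span T" for k
        unfolding Let_def by (rule BB2_T[OF that refl])
      show "\<forall>(t1, t2)\<in>T. (\<exists>a. red_mat t1 = mat a) \<and> (\<exists>b. red_mat t2 = mat b) \<longrightarrow>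
          red_mat t1 = red_mat t2"
        using red by blast
    qed
  qed
qed

end
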